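(* Let $\Omega\subset\mathbb C$ be a connected open set, $n\ge 2$, and let $T$ on $\mathcal H=\mathcal H_0\oplus\cdots\oplus\mathcal H_{n-1}$ and $\tilde T$ on $\tilde{\mathcal H}=\tilde{\mathcal H}_0\oplus\cdots\oplus\tilde{\mathcal H}_{n-1}$ be operators in $\mathcal FB_n(\Omega)$, written in decompositions as in the definition of $\mathcal FB_n(\Omega)$, with diagonal entries $T_i$, $\tilde T_i$ $(0\le i\le n-1)$ and strictly upper triangular entries $S_{i\,j}$, $\tilde S_{i\,j}$ $(0\le i<j\le n-1)$. (1) If $X:\mathcal H\to\tilde{\mathcal H}$ is an invertible bounded linear operator with $XT=\tilde TX$, then $X$ is upper triangular with respect to these decompositions, i.e. the block $X_{ij}:\mathcal H_j\to\tilde{\mathcal H}_i$ of $X$ is $0$ whenever $i>j$. (2) If $U:\mathcal H\to\tilde{\mathcal H}$ is a unitary operator with $UT=\tilde TU$, then $U$ is block diagonal with respect to these decompositions. (3) $T$ and $\tilde T$ are unitarily equivalent if and only if there exist unitary operators $U_i:\mathcal H_i\to\tilde{\mathcal H}_i$, $0\le i\le n-1$, such that $U_i^*\tilde T_iU_i=T_i$ for all $i$ and $U_iS_{i\,j}=\tilde S_{i\,j}U_j$ for all $i<j$.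
   Context: Hilbert spaces are complex and separable. For a connected open set $\Omega\subset\mathbb C$ and $n\ge 1$, the Cowen-Douglas class $B_n(\Omega)$ consists of the bounded linear operators $T$ on a Hilbert space $\mathcal H$ such that for every $w\in\Omega$: $\dim\ker(T-w)=n$, $\operatorname{ran}(T-w)=\mathcal H$, and such that the closed linear span of $\bigcup_{w\in\Omega}\ker(T-w)$ is $\mathcal H$. $\mathcal FB_n(\Omega)$ is the set of all $T\in B_n(\Omega)$ for which there are operators $T_0,\dots,T_{n-1}$ in $B_1(\Omega)$, acting on $\mathcal H_0,\dots,\mathcal H_{n-1}$, and an orthogonal decomposition $\mathcal H=\mathcal H_0\oplus\cdots\oplus\mathcal H_{n-1}$ with respect to which $T$ has the block upper triangular form $$T=\begin{pmatrix}T_0&S_{0\,1}&S_{0\,2}&\cdots&S_{0\,n-1}\\0&T_1&S_{1\,2}&\cdots&S_{1\,n-1}\\ \vdots&\ddots&\ddots&\ddots&\vdots\\0&\cdots&0&T_{n-2}&S_{n-2\,n-1}\\0&\cdots&\cdots&0&T_{n-1}\end{pmatrix},$$ where $S_{i\,j}:\mathcal H_j\to\mathcal H_i$ are bounded, none of the operators $S_{i\,i+1}$ is zero, and $T_iS_{i\,i+1}=S_{i\,i+1}T_{i+1}$ for $0\le i\le n-2$. *)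

theory Defs
  imports "HOL-Analysis.Analysis"
begin

section \<open>Separable complex Hilbert spaces\<close>

class complex_vector = real_vector +
  fixes scaleC :: "complex \<Rightarrow> 'a \<Rightarrow> 'a"  (infixr \<open>*\<^sub>C\<close> 75)
  assumes scaleC_add_right: "c *\<^sub>C (x + y) = c *\<^sub>C x + c *\<^sub>C y"
    and scaleC_add_left: "(c + d) *\<^sub>C x = c *\<^sub>C x + d *\<^sub>C x"
    and scaleC_scaleC: "c *\<^sub>C d *\<^sub>C x = (c * d) *\<^sub>C x"
    and scaleC_one: "1 *\<^sub>C x = x"
    and scaleR_scaleC: "r *\<^sub>R x = complex_of_real r *\<^sub>C x"

global_interpretation complex_vector:
  vector_space "scaleC :: complex \<Rightarrow> 'a \<Rightarrow> 'a::complex_vector"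
  defines cspan = complex_vector.span
    and csubspace = complex_vector.subspace
    and cdim = complex_vector.dim
  by unfold_locales
    (rule scaleC_add_right scaleC_add_left scaleC_scaleC scaleC_one)+

text \<open>The inner product is linear in its first argument.  Its positive definiteness follows from
  \<open>norm_eq_sqrt_cinner\<close> and the axioms of a normed space; completeness comes from \<open>banach\<close>.\<close>

class separable_chilbert_space = complex_vector + banach +
  fixes cinner :: "'a \<Rightarrow> 'a \<Rightarrow> complex"
  assumes cinner_commute: "cinner x y = cnj (cinner y x)"
    and cinner_add_left: "cinner (x + y) z = cinner x z + cinner y z"
    and cinner_scaleC_left: "cinner (c *\<^sub>C x) y = c * cinner x y"
    and norm_eq_sqrt_cinner: "norm x = sqrt (Re (cinner x x))"
    and countable_dense: "\<exists>D. countable D \<and> (\<forall>x. \<forall>e>0. \<exists>d\<in>D. dist d x < e)"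


section \<open>Operators between closed subspaces\<close>

text \<open>The summands of an orthogonal decomposition vary with an index, so they are closed subspaces
  of one ambient Hilbert space, and an operator \<open>M \<rightarrow> N\<close> is a function on the ambient space of which
  only the values on \<open>M\<close> matter.  An operator on the whole space is the case \<open>M = UNIV\<close>.\<close>

definition closed_csubspace :: "'a::separable_chilbert_space set \<Rightarrow> bool" where
  "closed_csubspace M \<longleftrightarrow> csubspace M \<and> closed M"

definition bounded_clinear_on ::
  "'a::separable_chilbert_space set \<Rightarrow> 'b::separable_chilbert_space set \<Rightarrow> ('a \<Rightarrow> 'b) \<Rightarrow> bool" where
  "bounded_clinear_on M N A \<longleftrightarrow>
     A ` M \<subseteq> N \<and>
     (\<forall>x\<in>M. \<forall>y\<in>M. A (x + y) = A x + A y) \<and>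
     (\<forall>c. \<forall>x\<in>M. A (c *\<^sub>C x) = c *\<^sub>C A x) \<and>
     (\<exists>K. \<forall>x\<in>M. norm (A x) \<le> K * norm x)"

definition invertible_operator ::
  "('a::separable_chilbert_space \<Rightarrow> 'b::separable_chilbert_space) \<Rightarrow> bool" where
  "invertible_operator X \<longleftrightarrow>
     bounded_clinear_on UNIV UNIV X \<and>
     (\<exists>Y. bounded_clinear_on UNIV UNIV Y \<and> Y \<circ> X = id \<and> X \<circ> Y = id)"

definition unitary_on ::
  "'a::separable_chilbert_space set \<Rightarrow> 'b::separable_chilbert_space set \<Rightarrow> ('a \<Rightarrow> 'b) \<Rightarrow> bool" where
  "unitary_on M N U \<longleftrightarrow>
     bounded_clinear_on M N U \<and> U ` M = N \<and>
     (\<forall>x\<in>M. \<forall>y\<in>M. cinner (U x) (U y) = cinner x y)"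

definition unitarily_equivalent ::
  "('a::separable_chilbert_space \<Rightarrow> 'a) \<Rightarrow> ('b::separable_chilbert_space \<Rightarrow> 'b) \<Rightarrow> bool" where
  "unitarily_equivalent T T' \<longleftrightarrow> (\<exists>U. unitary_on UNIV UNIV U \<and> U \<circ> T = T' \<circ> U)"

text \<open>The adjoint of an operator with domain \<open>M\<close>.\<close>

definition cadjoint_on ::
  "'a::separable_chilbert_space set \<Rightarrow> ('a \<Rightarrow> 'b::separable_chilbert_space) \<Rightarrow> 'b \<Rightarrow> 'a" where
  "cadjoint_on M A y = (THE z. z \<in> M \<and> (\<forall>x\<in>M. cinner (A x) y = cinner x z))"

text \<open>The orthogonal projection onto \<open>M\<close>.\<close>

definition cproj :: "'a::separable_chilbert_space set \<Rightarrow> 'a \<Rightarrow> 'a" where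
  "cproj M x = (THE y. y \<in> M \<and> (\<forall>z\<in>M. cinner (x - y) z = 0))"


section \<open>Block operators\<close>

definition orthogonal_decomposition ::
  "nat \<Rightarrow> (nat \<Rightarrow> 'a::separable_chilbert_space set) \<Rightarrow> bool" where
  "orthogonal_decomposition n H \<longleftrightarrow>
     (\<forall>i<n. closed_csubspace (H i)) \<and>
     (\<forall>i<n. \<forall>j<n. i \<noteq> j \<longrightarrow> (\<forall>x\<in>H i. \<forall>y\<in>H j. cinner x y = 0)) \<and>
     (\<forall>x. \<exists>f. (\<forall>i<n. f i \<in> H i) \<and> x = (\<Sum>i<n. f i))"

text \<open>The \<open>(i, j)\<close> block of \<open>X\<close> with respect to decompositions \<open>H\<close> of the domain and \<open>K\<close> of the
  codomain is the operator \<open>H j \<rightarrow> K i\<close> given by \<open>cproj (K i) (X x)\<close> for \<open>x \<in> H j\<close>.\<close>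

definition block_upper_triangular ::
  "nat \<Rightarrow> (nat \<Rightarrow> 'a::separable_chilbert_space set) \<Rightarrow> (nat \<Rightarrow> 'b::separable_chilbert_space set) \<Rightarrow>
    ('a \<Rightarrow> 'b) \<Rightarrow> bool" where
  "block_upper_triangular n H K X \<longleftrightarrow>
     (\<forall>i<n. \<forall>j<n. i > j \<longrightarrow> (\<forall>x\<in>H j. cproj (K i) (X x) = 0))"

definition block_diagonal ::
  "nat \<Rightarrow> (nat \<Rightarrow> 'a::separable_chilbert_space set) \<Rightarrow> (nat \<Rightarrow> 'b::separable_chilbert_space set) \<Rightarrow>
    ('a \<Rightarrow> 'b) \<Rightarrow> bool" where
  "block_diagonal n H K X \<longleftrightarrow>
     (\<forall>i<n. \<forall>j<n. i \<noteq> j \<longrightarrow> (\<forall>x\<in>H j. cproj (K i) (X x) = 0))"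


section \<open>The Cowen-Douglas class and the flag class\<close>

text \<open>\<open>cowen_douglas n \<Omega> M T\<close> says that \<open>T\<close>, as an operator on the Hilbert space \<open>M\<close>, belongs to
  \<open>B\<^sub>n(\<Omega>)\<close>.  Since \<open>cdim\<close> is \<open>0\<close> on infinite-dimensional spaces, \<open>n \<ge> 1\<close> makes the kernels
  genuinely \<open>n\<close>-dimensional.\<close>

definition cowen_douglas ::
  "nat \<Rightarrow> complex set \<Rightarrow> 'a::separable_chilbert_space set \<Rightarrow> ('a \<Rightarrow> 'a) \<Rightarrow> bool" where
  "cowen_douglas n \<Omega> M T \<longleftrightarrow>
     n \<ge> 1 \<and> closed_csubspace M \<and> bounded_clinear_on M M T \<and>
     (\<forall>w\<in>\<Omega>. cdim {x\<in>M. T x - w *\<^sub>C x = 0} = n \<and> (\<lambda>x. T x - w *\<^sub>C x) ` M = M) \<and>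
     closure (cspan (\<Union>w\<in>\<Omega>. {x\<in>M. T x - w *\<^sub>C x = 0})) = M"

definition flag_decomposition ::
  "nat \<Rightarrow> complex set \<Rightarrow> ('a::separable_chilbert_space \<Rightarrow> 'a) \<Rightarrow> (nat \<Rightarrow> 'a set) \<Rightarrow>
    (nat \<Rightarrow> 'a \<Rightarrow> 'a) \<Rightarrow> (nat \<Rightarrow> nat \<Rightarrow> 'a \<Rightarrow> 'a) \<Rightarrow> bool" where
  "flag_decomposition n \<Omega> T H D S \<longleftrightarrow>
     orthogonal_decomposition n H \<and>
     (\<forall>i<n. cowen_douglas 1 \<Omega> (H i) (D i)) \<and>
     (\<forall>j<n. \<forall>i<j. bounded_clinear_on (H j) (H i) (S i j)) \<and>
     block_upper_triangular n H H T \<and>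
     (\<forall>i<n. \<forall>x\<in>H i. cproj (H i) (T x) = D i x) \<and>
     (\<forall>j<n. \<forall>i<j. \<forall>x\<in>H j. cproj (H i) (T x) = S i j x) \<and>
     (\<forall>i. i + 1 < n \<longrightarrow> (\<exists>x\<in>H (i + 1). S i (i + 1) x \<noteq> 0)) \<and>
     (\<forall>i. i + 1 < n \<longrightarrow> (\<forall>x\<in>H (i + 1). D i (S i (i + 1) x) = S i (i + 1) (D (i + 1) x)))"

definition flag_class ::
  "nat \<Rightarrow> complex set \<Rightarrow> ('a::separable_chilbert_space \<Rightarrow> 'a) set" where
  "flag_class n \<Omega> =
     {T. cowen_douglas n \<Omega> UNIV T \<and> (\<exists>H D S. flag_decomposition n \<Omega> T H D S)}"

end

theory Submission
  imports Defs "HOL-Complex_Analysis.Complex_Analysis"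
begin

text \<open>An intertwiner of two operators in \<open>B\<^sub>1(\<Omega>)\<close> maps eigenvectors to eigenvectors, and by the open
  mapping theorem the eigenspaces have local holomorphic frames; hence the composition of two nonzero
  intertwiners is again nonzero.  By the argument of Kleinecke and Shirokov, a commutator
  \<open>X T - T X\<close> that commutes with \<open>T \<in> B\<^sub>1(\<Omega>)\<close> is zero.

  Let \<open>X\<close> be invertible with \<open>X T = T' X\<close>, and suppose that \<open>X\<close> and its inverse are upper triangular in
  the columns before the \<open>j\<close>-th.  If the lowest nonzero block \<open>X\<^sub>k\<^sub>j\<close> of column \<open>j\<close> were below the
  diagonal, the entries \<open>(k, j)\<close> and \<open>(k - 1, j)\<close> of \<open>X T = T' X\<close> would make \<open>S'\<^sub>k\<^sub>-\<^sub>1\<^sub>,\<^sub>k X\<^sub>k\<^sub>j\<close> a nonzero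
  intertwiner of the form \<open>Z D\<^sub>j - D'\<^sub>k\<^sub>-\<^sub>1 Z\<close>.  The superdiagonal entries of \<open>T\<close> and \<open>T'\<close> and a block of
  the inverse of \<open>X\<close> compose to a nonzero intertwiner back to \<open>H j\<close>, which leads to a nonzero commutator
  of the excluded kind.  A unitary intertwiner and its inverse are both upper triangular, so it is block
  diagonal, and the unitary invariants are read off blockwise.\<close>

section \<open>Bounded operators on closed subspaces\<close>

lemma cinner_add_right: "cinner x (y + z) = cinner x y + cinner x z"
  by (metis cinner_add_left cinner_commute complex_cnj_add)

lemma cinner_scaleC_right: "cinner x (c *\<^sub>C y) = cnj c * cinner x y"
  by (metis cinner_commute cinner_scaleC_left complex_cnj_mult)

lemma cinner_zero_left [simp]: "cinner 0 y = 0"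
  by (metis add_cancel_right_left cinner_add_left)

lemma cinner_zero_right [simp]: "cinner y 0 = 0"
  by (metis add_cancel_right_left cinner_add_right)

lemma cinner_diff_left: "cinner (x - y) z = cinner x z - cinner y z"
  by (metis add_diff_cancel cinner_add_left diff_add_cancel)

lemma cinner_diff_right: "cinner x (y - z) = cinner x y - cinner x z"
  by (metis add_diff_cancel cinner_add_right diff_add_cancel)

lemma cinner_sum_left: "cinner (sum f I) y = (\<Sum>i\<in>I. cinner (f i) y)"
  by (induction I rule: infinite_finite_induct) (auto simp: cinner_add_left)

lemma cinner_sum_right: "cinner y (sum f I) = (\<Sum>i\<in>I. cinner y (f i))"
  by (induction I rule: infinite_finite_induct) (auto simp: cinner_add_right)

lemma cinner_self: "cinner x x = complex_of_real ((norm x)\<^sup>2)"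
proof (rule complex_eqI)
  \<comment> \<open>Since \<open>sqrt\<close> is negative on negative reals, a nonnegative norm
    forces a nonnegative real part.\<close>
  have "Re (cinner x x) \<ge> 0"
    using norm_ge_zero[of x] norm_eq_sqrt_cinner[of x] by simp
  then show "Re (cinner x x) = Re (complex_of_real ((norm x)\<^sup>2))"
    by (simp add: norm_eq_sqrt_cinner)
  have "Im (cinner x x) = - Im (cinner x x)"
    using cinner_commute[of x x] by (metis cnj.simps(2))
  then show "Im (cinner x x) = Im (complex_of_real ((norm x)\<^sup>2))"
    by simp
qed

lemma cinner_self_eq_0_iff [simp]: "cinner x x = 0 \<longleftrightarrow> x = 0"
  by (simp add: cinner_self)

lemma norm_scaleC: "norm (c *\<^sub>C x) = cmod c * norm x"
  for x :: "'a::separable_chilbert_space"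
proof -
  have "complex_of_real ((norm (c *\<^sub>C x))\<^sup>2) = complex_of_real ((cmod c * norm x)\<^sup>2)"
    unfolding cinner_self[symmetric] power_mult_distrib of_real_mult complex_norm_square
    by (simp add: cinner_scaleC_left cinner_scaleC_right)
  then show ?thesis
    by (metis norm_ge_zero of_real_eq_iff power2_eq_iff_nonneg zero_le_mult_iff)
qed

lemma cmod_cinner_le: "cmod (cinner x y) \<le> norm x * norm y"
proof (cases "y = 0")
  case False
  define a where "a = cinner x y"
  \<comment> \<open>Up to the factor \<open>(norm y)\<^sup>2\<close>, \<open>z\<close> is the
    component of \<open>x\<close> orthogonal to \<open>y\<close>; Cauchy-Schwarz is the
    nonnegativity of its squared norm.\<close>
  define z where "z = complex_of_real ((norm y)\<^sup>2) *\<^sub>C x - a *\<^sub>C y"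
  have zy: "cinner z y = 0"
    by (simp add: z_def cinner_diff_left cinner_scaleC_left cinner_self a_def)
  have "cinner z z = complex_of_real ((norm y)\<^sup>2) * cinner z x"
    by (subst (2) z_def) (simp add: cinner_diff_right cinner_scaleC_right zy)
  also have "cinner z x = complex_of_real ((norm y)\<^sup>2 * (norm x)\<^sup>2 - (cmod a)\<^sup>2)"
    using cinner_commute[of y x] complex_norm_square[of a]
    by (simp add: z_def cinner_diff_left cinner_scaleC_left cinner_self a_def)
  finally have "(norm z)\<^sup>2 = (norm y)\<^sup>2 * ((norm y)\<^sup>2 * (norm x)\<^sup>2 - (cmod a)\<^sup>2)"
    by (metis cinner_self of_real_eq_iff of_real_mult)
  then have "0 \<le> (norm y)\<^sup>2 * ((norm y)\<^sup>2 * (norm x)\<^sup>2 - (cmod a)\<^sup>2)"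
    by (metis zero_le_power2)
  then have "(cmod a)\<^sup>2 \<le> (norm x * norm y)\<^sup>2"
    using False by (simp add: zero_le_mult_iff power_mult_distrib mult.commute)
  then show ?thesis
    unfolding a_def by (rule power2_le_imp_le) simp
qed simp

lemma bounded_linear_cinner_left: "bounded_linear (\<lambda>x. cinner x y)"
proof (rule bounded_linear_intro)
  show "cinner (r *\<^sub>R x) y = r *\<^sub>R cinner x y" for r x
    by (simp add: scaleR_scaleC cinner_scaleC_left scaleR_conv_of_real)
  show "cmod (cinner x y) \<le> norm x * norm y" for x
    by (rule cmod_cinner_le)
qed (rule cinner_add_left)

lemma bounded_linear_scaleC_right: "bounded_linear (\<lambda>x::'a::separable_chilbert_space. c *\<^sub>C x)"
proof (rule bounded_linear_intro)
  show "c *\<^sub>C r *\<^sub>R x = r *\<^sub>R c *\<^sub>C x" for r and x :: 'a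
    by (simp add: scaleR_scaleC complex_vector.scale_left_commute)
  show "norm (c *\<^sub>C x) \<le> norm x * cmod c" for x :: 'a
    by (simp add: norm_scaleC mult.commute)
qed (auto simp: scaleC_add_right)

section \<open>Closed subspaces and bounded operators between them\<close>

lemma closed_csubspaceD:
  assumes "closed_csubspace M"
  shows "csubspace M" "closed M" "0 \<in> M"
    and "x \<in> M \<Longrightarrow> y \<in> M \<Longrightarrow> x + y \<in> M"
    and "x \<in> M \<Longrightarrow> y \<in> M \<Longrightarrow> x - y \<in> M"
    and "x \<in> M \<Longrightarrow> c *\<^sub>C x \<in> M"
    and "x \<in> M \<Longrightarrow> r *\<^sub>R x \<in> M"
  using assms unfolding closed_csubspace_def
  by (auto intro: complex_vector.subspace_0 complex_vector.subspace_add
      complex_vector.subspace_diff complex_vector.subspace_scale simp: scaleR_scaleC)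

lemma closed_csubspace_sums:
  assumes "closed_csubspace M" and "\<And>k. a k \<in> M" and "a sums s"
  shows "s \<in> M"
proof -
  have "(\<Sum>k<n. a k) \<in> M" for n
    using closed_csubspaceD(1)[OF assms(1)] assms(2) by (intro complex_vector.subspace_sum) auto
  then show ?thesis
    by (rule closed_sequentially[OF closed_csubspaceD(2)[OF assms(1)]])
       (rule assms(3)[unfolded sums_def])
qed

lemma closed_csubspace_UNIV: "closed_csubspace UNIV"
  by (simp add: closed_csubspace_def complex_vector.subspace_UNIV)

context
  fixes M :: "'a::separable_chilbert_space set" and N :: "'b::separable_chilbert_space set"
    and A :: "'a \<Rightarrow> 'b"
  assumes M: "closed_csubspace M" and A: "bounded_clinear_on M N A"
begin

lemma bounded_clinear_on_mem: "x \<in> M \<Longrightarrow> A x \<in> N"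
  using A by (auto simp: bounded_clinear_on_def)

lemma bounded_clinear_on_add: "x \<in> M \<Longrightarrow> y \<in> M \<Longrightarrow> A (x + y) = A x + A y"
  using A unfolding bounded_clinear_on_def by blast

lemma bounded_clinear_on_scaleC: "x \<in> M \<Longrightarrow> A (c *\<^sub>C x) = c *\<^sub>C A x"
  using A unfolding bounded_clinear_on_def by blast

lemma bounded_clinear_on_scaleR: "x \<in> M \<Longrightarrow> A (r *\<^sub>R x) = r *\<^sub>R A x"
  by (simp add: scaleR_scaleC bounded_clinear_on_scaleC)

lemma bounded_clinear_on_zero: "A 0 = 0"
  using bounded_clinear_on_scaleC[OF closed_csubspaceD(3)[OF M], of 0] by simp

lemma bounded_clinear_on_diff: "x \<in> M \<Longrightarrow> y \<in> M \<Longrightarrow> A (x - y) = A x - A y"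
  by (metis M add_diff_cancel_right' bounded_clinear_on_add closed_csubspaceD(5) diff_add_cancel)

lemma bounded_clinear_on_sum:
  "(\<And>i. i \<in> I \<Longrightarrow> f i \<in> M) \<Longrightarrow> A (sum f I) = (\<Sum>i\<in>I. A (f i))"
proof (induction I rule: infinite_finite_induct)
  case (insert i I)
  then show ?case
    using complex_vector.subspace_sum[OF closed_csubspaceD(1)[OF M], of I f]
    by (simp add: bounded_clinear_on_add)
qed (auto simp: bounded_clinear_on_zero)

text \<open>The constant in the definition may be zero or negative; a positive one is convenient in
  products of estimates.\<close>

lemma bounded_clinear_on_bound:
  obtains K where "K > 0" "\<And>x. x \<in> M \<Longrightarrow> norm (A x) \<le> K * norm x"
proof -
  obtain K where K: "\<And>x. x \<in> M \<Longrightarrow> norm (A x) \<le> K * norm x"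
    using A unfolding bounded_clinear_on_def by blast
  have "norm (A x) \<le> (\<bar>K\<bar> + 1) * norm x" if "x \<in> M" for x
  proof -
    have "K * norm x \<le> (\<bar>K\<bar> + 1) * norm x"
      by (intro mult_right_mono) auto
    then show ?thesis
      using K[OF that] by linarith
  qed
  then show thesis
    by (intro that[of "\<bar>K\<bar> + 1"]) auto
qed

lemma bounded_clinear_on_tendsto:
  assumes "\<And>k. a k \<in> M" and "a \<longlonglongrightarrow> s"
  shows "(\<lambda>k. A (a k)) \<longlonglongrightarrow> A s"
proof -
  obtain K where K: "K > 0" "\<And>x. x \<in> M \<Longrightarrow> norm (A x) \<le> K * norm x"
    using bounded_clinear_on_bound by blast
  have s: "s \<in> M"
    using closed_csubspaceD(2)[OF M] assms unfolding closed_sequential_limits by blast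
  have "(\<lambda>k. A (a k) - A s) \<longlonglongrightarrow> 0"
  proof (rule Lim_null_comparison)
    show "\<forall>\<^sub>F k in sequentially. norm (A (a k) - A s) \<le> K * norm (a k - s)"
      using K(2) assms(1) s closed_csubspaceD(5)[OF M]
      by (auto simp: bounded_clinear_on_diff[symmetric])
    show "(\<lambda>k. K * norm (a k - s)) \<longlonglongrightarrow> 0"
      using assms(2) by (intro tendsto_mult_right_zero tendsto_norm_zero) (simp add: LIM_zero_iff)
  qed
  then show ?thesis
    by (simp add: LIM_zero_iff)
qed

text \<open>Continuity lets an operator act termwise, both on the series of corrections in the open
  mapping theorem and on power series of eigenvectors.\<close>

lemma bounded_clinear_on_sums:
  assumes "\<And>k. a k \<in> M" and "a sums s"
  shows "(\<lambda>k. A (a k)) sums A s"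
proof -
  have "(\<Sum>k<n. a k) \<in> M" for n
    using closed_csubspaceD(1)[OF M] assms(1) by (intro complex_vector.subspace_sum) auto
  then have "(\<lambda>n. A (\<Sum>k<n. a k)) \<longlonglongrightarrow> A s"
    using assms(2) by (intro bounded_clinear_on_tendsto) (simp_all add: sums_def)
  then show ?thesis
    using assms(1) by (simp add: sums_def bounded_clinear_on_sum)
qed

end

lemma bounded_clinear_on_compose:
  assumes "bounded_clinear_on M N A" "bounded_clinear_on N L B"
  shows "bounded_clinear_on M L (B \<circ> A)"
proof -
  obtain K where K: "\<forall>x\<in>M. norm (A x) \<le> K * norm x"
    using assms(1) by (auto simp: bounded_clinear_on_def)
  obtain K' where K': "\<forall>x\<in>N. norm (B x) \<le> K' * norm x"
    using assms(2) by (auto simp: bounded_clinear_on_def)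
  have "norm (B (A x)) \<le> (\<bar>K'\<bar> * K) * norm x" if "x \<in> M" for x
  proof -
    have "norm (B (A x)) \<le> K' * norm (A x)"
      using K' assms(1) that by (auto simp: bounded_clinear_on_def)
    also have "\<dots> \<le> \<bar>K'\<bar> * norm (A x)"
      by (simp add: mult_right_mono)
    also have "\<dots> \<le> \<bar>K'\<bar> * (K * norm x)"
      using K that by (simp add: mult_left_mono)
    finally show ?thesis by simp
  qed
  then show ?thesis
    using assms unfolding bounded_clinear_on_def by (auto 4 4 simp: image_subset_iff)
qed

lemma bounded_clinear_on_ident: "bounded_clinear_on M M (\<lambda>x. x)"
  unfolding bounded_clinear_on_def by (auto intro: exI[of _ 1])

lemma bounded_clinear_on_subset:
  assumes "bounded_clinear_on M N A" "M' \<subseteq> M" "A ` M' \<subseteq> N'"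
  shows "bounded_clinear_on M' N' A"
  using assms unfolding bounded_clinear_on_def by blast

lemma bounded_clinear_on_diff_scaleC:
  assumes M: "closed_csubspace M" and A: "bounded_clinear_on M M A"
  shows "bounded_clinear_on M M (\<lambda>x. A x - w *\<^sub>C x)"
proof -
  obtain K where K: "\<And>x. x \<in> M \<Longrightarrow> norm (A x) \<le> K * norm x"
    using A unfolding bounded_clinear_on_def by blast
  have "norm (A x - w *\<^sub>C x) \<le> (K + cmod w) * norm x" if "x \<in> M" for x
    using norm_triangle_ineq4[of "A x" "w *\<^sub>C x"] K[OF that]
    by (simp add: norm_scaleC algebra_simps)
  moreover have "A x - w *\<^sub>C x \<in> M" if "x \<in> M" for x
    using that by (intro closed_csubspaceD(5,6)[OF M] bounded_clinear_on_mem[OF M A])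
  ultimately show ?thesis
    unfolding bounded_clinear_on_def
    by (auto simp: bounded_clinear_on_add[OF M A] bounded_clinear_on_scaleC[OF M A] scaleC_add_right
        complex_vector.scale_right_diff_distrib complex_vector.scale_left_commute[of w])
qed

section \<open>The open mapping theorem\<close>

text \<open>The Baire category half of the open mapping theorem. The relatively closed sets
  \<open>C n\<close> exhaust \<open>N\<close> because \<open>A\<close> is onto, so one of them
  contains a relative ball of \<open>N\<close>. Subtracting approximate preimages of two points of
  this ball and rescaling yields approximate preimages of arbitrary vectors.\<close>

lemma approx_preimage:
  fixes A :: "'a::separable_chilbert_space \<Rightarrow> 'b::separable_chilbert_space"
  assumes M: "closed_csubspace M" and N: "closed_csubspace N"
    and A: "bounded_clinear_on M N A" and surj: "A ` M = N"
  obtains c where "c > 0"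
    "\<And>y. y \<in> N \<Longrightarrow> \<exists>x\<in>M. norm x \<le> c * norm y \<and> norm (y - A x) \<le> norm y / 2"
proof -
  define C where "C n = N \<inter> closure (A ` {x\<in>M. norm x \<le> real n})" for n
  have "\<Union>(range C) = N"
  proof (intro equalityI subsetI)
    fix y assume "y \<in> N"
    then obtain x where x: "x \<in> M" "y = A x"
      using surj by auto
    then have "y \<in> C (nat \<lceil>norm x\<rceil>)"
      using \<open>y \<in> N\<close> closure_subset unfolding C_def
      by (intro IntI subsetD[OF closure_subset]) (auto simp: real_nat_ceiling_ge)
    then show "y \<in> \<Union>(range C)" by blast
  qed (auto simp: C_def)
  moreover have "top_of_set N interior_of N = N"
    by (metis interior_of_topspace topspace_euclidean_subtopology)
  moreover have "completely_metrizable_space (top_of_set N)"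
    using closed_csubspaceD(2)[OF N] completely_metrizable_space_closedin
      completely_metrizable_space_euclidean by (metis closed_closedin)
  moreover have "closedin (top_of_set N) (C n)" for n
    unfolding C_def by (simp add: closedin_closed_Int)
  ultimately have "\<exists>n. top_of_set N interior_of C n \<noteq> {}"
    using Baire_category_alt[of "top_of_set N" "range C"] closed_csubspaceD(3)[OF N] by auto
  then obtain n where n: "top_of_set N interior_of C n \<noteq> {}" ..
  then obtain y0 e where y0: "y0 \<in> N" "e > 0" "\<And>y. y \<in> N \<Longrightarrow> dist y y0 < e \<Longrightarrow> y \<in> C n"
    unfolding interior_of_def openin_euclidean_subtopology_iff by blast
  have approx: "\<exists>x\<in>M. norm x \<le> real n \<and> dist (A x) y < \<delta>"
    if "y \<in> N" "dist y y0 < e" "\<delta> > 0" for y \<delta>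
    using y0(3)[OF that(1,2)] that(3) unfolding C_def by (auto simp: closure_approachable)
  \<comment> \<open>With the scaling \<open>t\<close> chosen below, the approximate preimage has
    norm at most \<open>2 * n / t = 4 * n / e * norm y\<close>; the summand 1 keeps \<open>c\<close>
    positive when \<open>n = 0\<close>.\<close>
  define c where "c = 4 * real n / e + 1"
  show thesis
  proof (rule that[of c])
    show "c > 0"
      using y0(2) by (simp add: c_def add_nonneg_pos)
    fix y assume y: "y \<in> N"
    show "\<exists>x\<in>M. norm x \<le> c * norm y \<and> norm (y - A x) \<le> norm y / 2"
    proof (cases "y = 0")
      case True
      then show ?thesis
        using closed_csubspaceD(3)[OF M] bounded_clinear_on_zero[OF M A]
        by (intro bexI[of _ 0]) auto
    next
      case False
      \<comment> \<open>This places \<open>y0 + t *\<^sub>R y\<close> at distance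
        \<open>e / 2\<close> from \<open>y0\<close>. Two errors below \<open>e / 8\<close> then add
        up to at most \<open>e / 4 = t * (norm y / 2)\<close>.\<close>
      define t where "t = e / (2 * norm y)"
      have t: "t > 0" "t * norm y = e / 2"
        using False y0(2) by (simp_all add: t_def)
      have "dist (y0 + t *\<^sub>R y) y0 < e"
        using t y0(2) by (simp add: dist_norm)
      moreover have "y0 + t *\<^sub>R y \<in> N"
        using y y0(1) by (intro closed_csubspaceD(4,7)[OF N])
      ultimately obtain x1 where x1: "x1 \<in> M" "norm x1 \<le> real n" "dist (A x1) (y0 + t *\<^sub>R y) < e / 8"
        using approx[of "y0 + t *\<^sub>R y" "e / 8"] y0(2) by auto
      obtain x2 where x2: "x2 \<in> M" "norm x2 \<le> real n" "dist (A x2) y0 < e / 8"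
        using approx[of y0 "e / 8"] y0 by auto
      define x where "x = (1 / t) *\<^sub>R (x1 - x2)"
      have d: "x1 - x2 \<in> M"
        using x1 x2 by (intro closed_csubspaceD(5)[OF M])
      have x: "x \<in> M"
        unfolding x_def using closed_csubspaceD(7)[OF M d] .
      have "norm x = norm (x1 - x2) / t"
        using t by (simp add: x_def)
      also have "\<dots> \<le> (2 * real n) / t"
        using t x1 x2 norm_triangle_ineq4[of x1 x2] by (intro divide_right_mono) auto
      also have "\<dots> = (4 * real n / e) * norm y"
        using False by (simp add: t_def)
      also have "\<dots> \<le> c * norm y"
        unfolding c_def by (intro mult_right_mono) auto
      finally have "norm x \<le> c * norm y" .
      moreover have "norm (y - A x) \<le> norm y / 2"
      proof -
        have "A x = (1 / t) *\<^sub>R (A x1 - A x2)"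
          using bounded_clinear_on_scaleR[OF M A d] bounded_clinear_on_diff[OF M A] x1 x2
          by (simp add: x_def)
        then have "t *\<^sub>R (y - A x) = (A x2 - y0) - (A x1 - (y0 + t *\<^sub>R y))"
          using t by (simp add: scaleR_diff_right)
        then have "t * norm (y - A x) \<le> dist (A x2) y0 + dist (A x1) (y0 + t *\<^sub>R y)"
          using norm_triangle_ineq4[of "A x2 - y0" "A x1 - (y0 + t *\<^sub>R y)"] t
          by (metis abs_of_pos dist_norm norm_scaleR)
        also have "\<dots> \<le> t * (norm y / 2)"
          using x1(3) x2(3) t by simp
        finally show ?thesis
          using t(1) by simp
      qed
      ultimately show ?thesis
        using x by blast
    qed
  qed
qed

text \<open>Correcting by approximate preimages halves the residual each time. The corrections form
  a convergent series by completeness, and the geometric sum turns \<open>c\<close> into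
  \<open>2 * c\<close>.\<close>

lemma open_mapping_bounded_preimage:
  fixes A :: "'a::separable_chilbert_space \<Rightarrow> 'b::separable_chilbert_space"
  assumes M: "closed_csubspace M" and N: "closed_csubspace N"
    and A: "bounded_clinear_on M N A" and surj: "A ` M = N"
  obtains C where "C > 0" "\<And>y. y \<in> N \<Longrightarrow> \<exists>x\<in>M. A x = y \<and> norm x \<le> C * norm y"
proof -
  obtain c where c: "c > 0"
    "\<And>y. y \<in> N \<Longrightarrow> \<exists>x\<in>M. norm x \<le> c * norm y \<and> norm (y - A x) \<le> norm y / 2"
    using approx_preimage[OF assms] by blast
  then obtain f where f: "\<And>y. y \<in> N \<Longrightarrow> f y \<in> M" "\<And>y. y \<in> N \<Longrightarrow> norm (f y) \<le> c * norm y"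
    "\<And>y. y \<in> N \<Longrightarrow> norm (y - A (f y)) \<le> norm y / 2"
    by metis
  show thesis
  proof (rule that[of "2 * c"])
    show "2 * c > 0" using c(1) by simp
    fix y assume y: "y \<in> N"
    \<comment> \<open>\<open>r k\<close> is what remains of \<open>y\<close> after \<open>k\<close>
      corrections.\<close>
    define r where "r k = ((\<lambda>z. z - A (f z)) ^^ k) y" for k
    have r: "r 0 = y" "r (Suc k) = r k - A (f (r k))" for k
      by (simp_all add: r_def)
    have rN: "r k \<in> N" for k
    proof (induction k)
      case (Suc k)
      then show ?case
        using closed_csubspaceD(5)[OF N] bounded_clinear_on_mem[OF M A] f(1) by (simp add: r)
    qed (simp add: r y)
    have rn: "norm (r k) \<le> norm y * (1 / 2) ^ k" for k
    proof (induction k)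
      case (Suc k)
      then show ?case
        using f(3)[OF rN[of k]] r(2)[of k] by simp
    qed (simp add: r)
    have fM: "f (r k) \<in> M" for k
      using f rN by blast
    have fn: "norm (f (r k)) \<le> c * norm y * (1 / 2) ^ k" for k
    proof -
      have "c * norm (r k) \<le> c * (norm y * (1 / 2) ^ k)"
        using c(1) by (intro mult_left_mono rn) simp
      then show ?thesis
        using f(2)[OF rN[of k]] by (simp only: mult.assoc)
    qed
    have geo: "(\<lambda>k. c * norm y * (1 / 2) ^ k) sums (c * norm y * 2)"
      using geometric_sums[of "1 / 2 :: real"] by (intro sums_mult) simp
    have sn: "summable (\<lambda>k. norm (f (r k)))"
      by (rule summable_comparison_test'[OF sums_summable[OF geo], of 0]) (use fn in simp)
    define x where "x = (\<Sum>k. f (r k))"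
    have sx: "(\<lambda>k. f (r k)) sums x"
      unfolding x_def using summable_norm_cancel[OF sn] by (rule summable_sums)
    have "x \<in> M"
      using closed_csubspace_sums[OF M fM sx] .
    moreover have "A x = y"
    proof -
      have "r \<longlonglongrightarrow> 0"
      proof (rule Lim_null_comparison)
        show "(\<lambda>k. norm y * (1 / 2) ^ k) \<longlonglongrightarrow> 0"
          by (intro tendsto_mult_right_zero LIMSEQ_power_zero) simp
      qed (use rn in simp)
      \<comment> \<open>Each difference is \<open>A (f (r k))\<close>, so the image series
        telescopes to \<open>y\<close>.\<close>
      then have "(\<lambda>k. r k - r (Suc k)) sums (r 0 - 0)"
        by (rule telescope_sums')
      then have "(\<lambda>k. A (f (r k))) sums y"
        by (simp add: r)
      then show ?thesis
        using bounded_clinear_on_sums[OF M A fM sx] sums_unique2 by blast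
    qed
    moreover have "norm x \<le> 2 * c * norm y"
    proof -
      have "norm x \<le> (\<Sum>k. norm (f (r k)))"
        unfolding x_def by (rule summable_norm[OF sn])
      also have "\<dots> \<le> c * norm y * 2"
        using suminf_le[OF fn sn sums_summable[OF geo]] sums_unique[OF geo] by simp
      finally show ?thesis by simp
    qed
    ultimately show "\<exists>x\<in>M. A x = y \<and> norm x \<le> 2 * c * norm y"
      by blast
  qed
qed

section \<open>Eigenspaces of operators in the Cowen-Douglas class\<close>

text \<open>Testing against a fixed vector reduces vector-valued series to scalar power series. The
  varying vector stands in the linear argument of \<open>cinner\<close>, which gives
  holomorphy.\<close>

lemma cinner_power_series_holomorphic:
  assumes "\<And>w. w \<in> ball w0 r \<Longrightarrow> (\<lambda>k. (w - w0) ^ k *\<^sub>C b k) sums g w"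
  shows "(\<lambda>w. cinner (g w) y) holomorphic_on ball w0 r"
proof (rule power_series_holomorphic)
  fix w assume "w \<in> ball w0 r"
  from bounded_linear.sums[OF bounded_linear_cinner_left assms[OF this]]
  show "(\<lambda>k. cinner (b k) y * (w - w0) ^ k) sums cinner (g w) y"
    by (simp add: cinner_scaleC_left mult.commute)
qed

lemma cowen_douglasD:
  assumes "cowen_douglas n \<Omega> M T"
  shows "closed_csubspace M" "bounded_clinear_on M M T"
    and "w \<in> \<Omega> \<Longrightarrow> cdim {x\<in>M. T x = w *\<^sub>C x} = n"
    and "w \<in> \<Omega> \<Longrightarrow> (\<lambda>x. T x - w *\<^sub>C x) ` M = M"
    and "closure (cspan (\<Union>w\<in>\<Omega>. {x\<in>M. T x = w *\<^sub>C x})) = M"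
  using assms by (auto simp: cowen_douglas_def)

lemma cowen_douglas_eigenvector:
  assumes "cowen_douglas 1 \<Omega> M T" "w \<in> \<Omega>"
  obtains g where "g \<in> M" "g \<noteq> 0" "T g = w *\<^sub>C g"
    "\<And>x. x \<in> M \<Longrightarrow> T x = w *\<^sub>C x \<Longrightarrow> \<exists>c. x = c *\<^sub>C g"
proof -
  obtain B where B: "B \<subseteq> {x\<in>M. T x = w *\<^sub>C x}" "\<not> complex_vector.dependent B"
    "{x\<in>M. T x = w *\<^sub>C x} \<subseteq> cspan B"
    "card B = cdim {x\<in>M. T x = w *\<^sub>C x}"
    by (rule complex_vector.basis_exists)
  have "card B = 1"
    using B(4) cowen_douglasD(3)[OF assms] by simp
  then obtain g where g: "B = {g}"
    by (rule card_1_singletonE)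
  show thesis
  proof (rule that)
    show "g \<in> M" "T g = w *\<^sub>C g" using B g by auto
    show "g \<noteq> 0" using B(2) g complex_vector.dependent_zero by blast
    show "\<exists>c. x = c *\<^sub>C g" if "x \<in> M" "T x = w *\<^sub>C x" for x
      using B(3) that unfolding g complex_vector.span_singleton by blast
  qed
qed

lemma cowen_douglas_ex_eigenvector:
  assumes "cowen_douglas 1 \<Omega> M T" "w \<in> \<Omega>"
  shows "\<exists>g\<in>M. g \<noteq> 0 \<and> T g = w *\<^sub>C g"
  by (rule cowen_douglas_eigenvector[OF assms]) blast

lemma cowen_douglas_eigenvector_unique:
  assumes "cowen_douglas 1 \<Omega> M T" "w \<in> \<Omega>"
    and "x \<in> M" "T x = w *\<^sub>C x" "g \<in> M" "T g = w *\<^sub>C g" "g \<noteq> 0"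
  obtains c where "x = c *\<^sub>C g"
proof -
  obtain h where h: "\<And>x. x \<in> M \<Longrightarrow> T x = w *\<^sub>C x \<Longrightarrow> \<exists>c. x = c *\<^sub>C h"
    using cowen_douglas_eigenvector[OF assms(1,2)] by blast
  obtain a b where "x = a *\<^sub>C h" "g = b *\<^sub>C h"
    using h assms by blast
  moreover from this have "b \<noteq> 0"
    using assms(7) by auto
  ultimately have "x = (a / b) *\<^sub>C g"
    by (simp add: scaleC_scaleC)
  then show thesis by (rule that)
qed

text \<open>A frame of the eigenspaces near \<open>w0\<close> is \<open>\<Sum>k. (w - w0) ^ k *\<^sub>C a k\<close>, where \<open>a 0\<close> is an
  eigenvector at \<open>w0\<close> and \<open>a (Suc k)\<close> is a preimage of \<open>a k\<close> under \<open>T - w0\<close>.\<close>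

lemma cowen_douglas_frame:
  assumes cd: "cowen_douglas 1 \<Omega> M T" and "open \<Omega>" "w0 \<in> \<Omega>"
  obtains r a g where "r > 0" "ball w0 r \<subseteq> \<Omega>" "\<And>k. a k \<in> M"
    "\<And>w. w \<in> ball w0 r \<Longrightarrow> (\<lambda>k. (w - w0) ^ k *\<^sub>C a k) sums g w"
    "\<And>w. w \<in> ball w0 r \<Longrightarrow> g w \<in> M"
    "\<And>w. w \<in> ball w0 r \<Longrightarrow> g w \<noteq> 0"
    "\<And>w. w \<in> ball w0 r \<Longrightarrow> T (g w) = w *\<^sub>C g w"
proof -
  note M = cowen_douglasD(1)[OF cd] and T = cowen_douglasD(2)[OF cd]
  define N where "N x = T x - w0 *\<^sub>C x" for x
  have N: "bounded_clinear_on M M N"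
    unfolding N_def by (rule bounded_clinear_on_diff_scaleC[OF M T])
  have "N ` M = M"
    unfolding N_def by (rule cowen_douglasD(4)[OF cd \<open>w0 \<in> \<Omega>\<close>])
  then obtain C where C: "C > 0" "\<And>y. y \<in> M \<Longrightarrow> \<exists>x\<in>M. N x = y \<and> norm x \<le> C * norm y"
    using open_mapping_bounded_preimage[OF M M N] by blast
  \<comment> \<open>A pointwise choice of preimages under \<open>N\<close>, with norms controlled by
    the open mapping theorem.\<close>
  then obtain f where f: "\<And>y. y \<in> M \<Longrightarrow> f y \<in> M" "\<And>y. y \<in> M \<Longrightarrow> N (f y) = y"
    "\<And>y. y \<in> M \<Longrightarrow> norm (f y) \<le> C * norm y"
    by metis
  obtain v where v: "v \<in> M" "v \<noteq> 0" "T v = w0 *\<^sub>C v"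
    using cowen_douglas_ex_eigenvector[OF cd \<open>w0 \<in> \<Omega>\<close>] by blast
  define a where "a k = (f ^^ k) v" for k
  have a0: "a 0 = v" and aSuc: "a (Suc k) = f (a k)" for k
    by (simp_all add: a_def)
  have aM: "a k \<in> M" for k
    by (induction k) (use v f in \<open>auto simp: a0 aSuc\<close>)
  have Na: "N (a 0) = 0" "N (a (Suc k)) = a k" for k
    using v(3) f(2)[OF aM] by (simp_all add: a0 aSuc N_def)
  have na: "norm (a k) \<le> C ^ k * norm v" for k
  proof (induction k)
    case (Suc k)
    have "norm (a (Suc k)) \<le> C * norm (a k)"
      using f(3)[OF aM] by (simp add: aSuc)
    also have "\<dots> \<le> C * (C ^ k * norm v)"
      using Suc C(1) by (intro mult_left_mono) auto
    finally show ?case by simp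
  qed (simp add: a0)
  \<comment> \<open>The norms of \<open>a k\<close> grow at most geometrically with ratio
    \<open>C\<close>, so the series converges on the ball of radius \<open>1 / C\<close>.\<close>
  define g where "g w = (\<Sum>k. (w - w0) ^ k *\<^sub>C a k)" for w
  have g: "(\<lambda>k. (w - w0) ^ k *\<^sub>C a k) sums g w" if "w \<in> ball w0 (1 / C)" for w
  proof -
    have "cmod (w - w0) * C < 1"
      using that C(1) by (simp add: dist_norm norm_minus_commute field_simps)
    then have "summable (\<lambda>k. norm v * (cmod (w - w0) * C) ^ k)"
      using C(1) by (intro summable_mult summable_geometric) (simp add: abs_mult)
    then have "summable (\<lambda>k. norm ((w - w0) ^ k *\<^sub>C a k))"
    proof (rule summable_comparison_test'[where N = 0])
      fix k
      show "norm (norm ((w - w0) ^ k *\<^sub>C a k)) \<le> norm v * (cmod (w - w0) * C) ^ k"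
        using mult_left_mono[OF na[of k], of "cmod (w - w0) ^ k"]
        by (simp add: norm_scaleC norm_power power_mult_distrib mult_ac)
    qed
    then show ?thesis
      unfolding g_def by (rule summable_sums[OF summable_norm_cancel])
  qed
  have gM: "g w \<in> M" if "w \<in> ball w0 (1 / C)" for w
    using closed_csubspace_sums[OF M _ g[OF that]] closed_csubspaceD(6)[OF M] aM by blast
  have Tg: "T (g w) = w *\<^sub>C g w" if w: "w \<in> ball w0 (1 / C)" for w
  proof -
    have "(\<lambda>k. N ((w - w0) ^ k *\<^sub>C a k)) sums N (g w)"
      using bounded_clinear_on_sums[OF M N _ g[OF w]] closed_csubspaceD(6)[OF M] aM by blast
    then have "(\<lambda>k. (w - w0) ^ k *\<^sub>C N (a k)) sums N (g w)"
      by (simp add: bounded_clinear_on_scaleC[OF M N] aM)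
    \<comment> \<open>The term at \<open>k = 0\<close> vanishes because \<open>N (a 0) = 0\<close>;
      the index shift then exhibits a factor \<open>w - w0\<close>.\<close>
    then have "(\<lambda>k. (w - w0) ^ Suc k *\<^sub>C a k) sums N (g w)"
      using sums_Suc_iff[of "\<lambda>k. (w - w0) ^ k *\<^sub>C N (a k)" "N (g w)"] by (simp add: Na)
    moreover have "(\<lambda>k. (w - w0) ^ Suc k *\<^sub>C a k) sums ((w - w0) *\<^sub>C g w)"
      using bounded_linear.sums[OF bounded_linear_scaleC_right[of "w - w0"] g[OF w]]
      by (simp add: scaleC_scaleC)
    ultimately have "N (g w) = (w - w0) *\<^sub>C g w"
      by (rule sums_unique2)
    then show ?thesis
      by (simp add: N_def complex_vector.scale_left_diff_distrib)
  qed
  have w0: "w0 \<in> ball w0 (1 / C)"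
    using C(1) by simp
  have "(\<lambda>k. (w0 - w0) ^ k *\<^sub>C a k) sums a 0"
  proof -
    have "(\<lambda>k. (w0 - w0) ^ k *\<^sub>C a k) sums (\<Sum>k\<in>{0}. (w0 - w0) ^ k *\<^sub>C a k)"
      by (rule sums_finite) auto
    then show ?thesis by (simp add: scaleC_one)
  qed
  then have "g w0 = v"
    using g[OF w0] sums_unique2 a0 by metis
  \<comment> \<open>At \<open>w0\<close> this function has the value \<open>cinner v v\<close>,
    which is nonzero. It stays nonzero near \<open>w0\<close>, and so does \<open>g\<close>.\<close>
  moreover have "continuous_on (ball w0 (1 / C)) (\<lambda>w. cinner (g w) v)"
    using cinner_power_series_holomorphic[OF g] holomorphic_on_imp_continuous_on by blast
  ultimately obtain e where e: "e > 0"
    "\<And>w. w \<in> ball w0 (1 / C) \<Longrightarrow> dist w0 w < e \<Longrightarrow> cinner (g w) v \<noteq> 0"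
    using continuous_on_avoid[of "ball w0 (1 / C)" "\<lambda>w. cinner (g w) v" w0 0] w0 v(2) by auto
  obtain d where d: "d > 0" "ball w0 d \<subseteq> \<Omega>"
    using \<open>open \<Omega>\<close> \<open>w0 \<in> \<Omega>\<close> open_contains_ball by blast
  \<comment> \<open>The three radii ensure convergence, a nonvanishing frame, and a ball inside
    \<Omega>.\<close>
  define r where "r = min (1 / C) (min e d)"
  have r: "ball w0 r \<subseteq> ball w0 (1 / C)" "ball w0 r \<subseteq> ball w0 d" "ball w0 r \<subseteq> ball w0 e"
    by (auto simp: r_def)
  show thesis
  proof (rule that[of r a g])
    show "r > 0" using C(1) e(1) d(1) by (simp add: r_def)
    show "ball w0 r \<subseteq> \<Omega>" using r(2) d(2) by blast
    fix w assume w: "w \<in> ball w0 r"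
    then have w': "w \<in> ball w0 (1 / C)" using r(1) by blast
    show "(\<lambda>k. (w - w0) ^ k *\<^sub>C a k) sums g w" "g w \<in> M" "T (g w) = w *\<^sub>C g w"
      using g[OF w'] gM[OF w'] Tg[OF w'] by blast+
    show "g w \<noteq> 0" using e(2)[OF w'] r(3) w by auto
  qed (rule aM)
qed

section \<open>Operators that vanish on an eigenspace\<close>

definition kills_eigenspace ::
  "'a::separable_chilbert_space set \<Rightarrow> ('a \<Rightarrow> 'a) \<Rightarrow> ('a \<Rightarrow> 'b::separable_chilbert_space) \<Rightarrow> complex \<Rightarrow> bool"
  where "kills_eigenspace M T A w \<longleftrightarrow> (\<forall>x\<in>M. T x = w *\<^sub>C x \<longrightarrow> A x = 0)"

text \<open>Eigenspaces are one-dimensional, so a single eigenvector decides. The predicate itself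
  speaks of the whole eigenspace, which makes it meaningful on all of \<Omega> although frames are
  only local.\<close>

lemma kills_eigenspace_iff:
  assumes "cowen_douglas 1 \<Omega> M T" "w \<in> \<Omega>" and A: "bounded_clinear_on M N A"
    and "g \<in> M" "T g = w *\<^sub>C g" "g \<noteq> 0"
  shows "kills_eigenspace M T A w \<longleftrightarrow> A g = 0"
proof
  assume *: "A g = 0"
  show "kills_eigenspace M T A w"
    unfolding kills_eigenspace_def
  proof (intro ballI impI)
    fix x assume "x \<in> M" "T x = w *\<^sub>C x"
    then obtain c where "x = c *\<^sub>C g"
      using cowen_douglas_eigenvector_unique assms by blast
    then show "A x = 0"
      using bounded_clinear_on_scaleC[OF cowen_douglasD(1)[OF assms(1)] A \<open>g \<in> M\<close>] * by simp
  qed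
qed (use assms in \<open>auto simp: kills_eigenspace_def\<close>)

text \<open>The vectors of \<open>M\<close> annihilated by \<open>A\<close> form a closed subspace
  that contains every eigenvector, and eigenvectors span a dense subspace.\<close>

lemma zero_if_kills_eigenspaces:
  assumes cd: "cowen_douglas n \<Omega> M T" and A: "bounded_clinear_on M N A"
    and kill: "\<And>w. w \<in> \<Omega> \<Longrightarrow> kills_eigenspace M T A w" and "x \<in> M"
  shows "A x = 0"
proof -
  note M = cowen_douglasD(1)[OF cd]
  let ?E = "\<Union>w\<in>\<Omega>. {x\<in>M. T x = w *\<^sub>C x}"
  have "csubspace {x\<in>M. A x = 0}"
    unfolding complex_vector.subspace_def
    by (auto simp: closed_csubspaceD(3,4,6)[OF M] bounded_clinear_on_zero[OF M A]
        bounded_clinear_on_add[OF M A] bounded_clinear_on_scaleC[OF M A])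
  moreover have "?E \<subseteq> {x\<in>M. A x = 0}"
    using kill by (auto simp: kills_eigenspace_def)
  ultimately have span: "cspan ?E \<subseteq> {x\<in>M. A x = 0}"
    by (intro complex_vector.span_minimal)
  have "x \<in> closure (cspan ?E)"
    using cowen_douglasD(5)[OF cd] \<open>x \<in> M\<close> by simp
  then obtain s where s: "\<And>k. s k \<in> cspan ?E" "s \<longlonglongrightarrow> x"
    unfolding closure_sequential by blast
  have "(\<lambda>k. A (s k)) \<longlonglongrightarrow> A x"
    using bounded_clinear_on_tendsto[OF M A _ s(2)] s(1) span by blast
  moreover have "A (s k) = 0" for k
    using s(1) span by blast
  ultimately show ?thesis
    by (simp add: LIMSEQ_const_iff)
qed

text \<open>Take \<open>h w = A (g w)\<close> for a local frame \<open>g\<close>, with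
  \<open>A\<close> applied termwise to its power series. The condition on eigenspaces becomes the
  vanishing of a weakly holomorphic function.\<close>

lemma kills_eigenspace_locally:
  fixes A :: "'a::separable_chilbert_space \<Rightarrow> 'b::separable_chilbert_space"
  assumes cd: "cowen_douglas 1 \<Omega> M T" and "open \<Omega>" "w0 \<in> \<Omega>" and A: "bounded_clinear_on M N A"
  shows "\<exists>r>0. \<exists>h :: complex \<Rightarrow> 'b. ball w0 r \<subseteq> \<Omega> \<and>
    (\<forall>w\<in>ball w0 r. kills_eigenspace M T A w \<longleftrightarrow> h w = 0) \<and>
    (\<forall>y. (\<lambda>w. cinner (h w) y) holomorphic_on ball w0 r)"
proof -
  note M = cowen_douglasD(1)[OF cd]
  obtain r a g where rag: "r > 0" "ball w0 r \<subseteq> \<Omega>" "\<And>k. a k \<in> M"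
    "\<And>w. w \<in> ball w0 r \<Longrightarrow> (\<lambda>k. (w - w0) ^ k *\<^sub>C a k) sums g w"
    "\<And>w. w \<in> ball w0 r \<Longrightarrow> g w \<in> M"
    "\<And>w. w \<in> ball w0 r \<Longrightarrow> g w \<noteq> 0"
    "\<And>w. w \<in> ball w0 r \<Longrightarrow> T (g w) = w *\<^sub>C g w"
    using cowen_douglas_frame[OF assms(1-3)] by blast
  have "(\<lambda>k. (w - w0) ^ k *\<^sub>C A (a k)) sums A (g w)" if "w \<in> ball w0 r" for w
    using bounded_clinear_on_sums[OF M A _ rag(4)[OF that]] closed_csubspaceD(6)[OF M rag(3)]
    by (simp add: bounded_clinear_on_scaleC[OF M A rag(3)])
  then have "(\<lambda>w. cinner (A (g w)) y) holomorphic_on ball w0 r" for y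
    by (rule cinner_power_series_holomorphic)
  moreover have "kills_eigenspace M T A w \<longleftrightarrow> A (g w) = 0" if "w \<in> ball w0 r" for w
    using kills_eigenspace_iff[OF cd _ A] rag that by blast
  ultimately have "ball w0 r \<subseteq> \<Omega> \<and>
      (\<forall>w\<in>ball w0 r. kills_eigenspace M T A w \<longleftrightarrow> A (g w) = 0) \<and>
      (\<forall>y. (\<lambda>w. cinner (A (g w)) y) holomorphic_on ball w0 r)"
    using rag(2) by blast
  then have "\<exists>h :: complex \<Rightarrow> 'b. ball w0 r \<subseteq> \<Omega> \<and>
      (\<forall>w\<in>ball w0 r. kills_eigenspace M T A w \<longleftrightarrow> h w = 0) \<and>
      (\<forall>y. (\<lambda>w. cinner (h w) y) holomorphic_on ball w0 r)"
    by (rule exI[of _ "\<lambda>w. A (g w)"])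
  then show ?thesis
    using rag(1) by blast
qed

text \<open>An identity theorem: the interior of the set of points where \<open>A\<close> kills the
  eigenspace is nonempty, open, and relatively closed in \<Omega>, hence all of \<Omega> by
  connectedness.\<close>

lemma zero_if_kills_eigenspaces_open:
  fixes A :: "'a::separable_chilbert_space \<Rightarrow> 'b::separable_chilbert_space"
  assumes cd: "cowen_douglas 1 \<Omega> M T" and \<Omega>: "open \<Omega>" "connected \<Omega>"
    and A: "bounded_clinear_on M N A"
    and U: "open U" "U \<noteq> {}" "U \<subseteq> \<Omega>" "\<And>w. w \<in> U \<Longrightarrow> kills_eigenspace M T A w" and "x \<in> M"
  shows "A x = 0"
proof -
  define Z where "Z = interior {w\<in>\<Omega>. kills_eigenspace M T A w}"
  have "\<exists>r>0. ball w0 r \<subseteq> \<Omega> - Z" if w0: "w0 \<in> \<Omega> - Z" for w0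
  proof -
    have "w0 \<in> \<Omega>"
      using w0 by simp
    then obtain r and h :: "complex \<Rightarrow> 'b" where rh: "r > 0" "ball w0 r \<subseteq> \<Omega>"
      "\<forall>w\<in>ball w0 r. kills_eigenspace M T A w \<longleftrightarrow> h w = 0"
      "\<forall>y. (\<lambda>w. cinner (h w) y) holomorphic_on ball w0 r"
      using kills_eigenspace_locally[OF cd \<Omega>(1) _ A] by blast
    have "ball w0 r \<inter> Z = {}"
    proof (rule ccontr)
      assume ne: "ball w0 r \<inter> Z \<noteq> {}"
      have "h w = 0" if w: "w \<in> ball w0 r" for w
      proof -
        \<comment> \<open>Analytic continuation is applied to the scalar function
          \<open>\<lambda>z. cinner (h z) (h w)\<close> with \<open>w\<close> fixed, and then
          evaluated at \<open>z = w\<close>.\<close>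
        have "cinner (h w) (h w) = 0"
        proof (rule analytic_continuation_open
            [where f = "\<lambda>z. cinner (h z) (h w)" and g = "\<lambda>_. 0" and z = w
              and s' = "ball w0 r"])
          show "open (ball w0 r \<inter> Z)"
            by (simp add: Z_def open_Int)
          show "cinner (h z) (h w) = 0" if "z \<in> ball w0 r \<inter> Z" for z
          proof -
            have "kills_eigenspace M T A z"
              using that interior_subset unfolding Z_def by blast
            then show ?thesis
              using rh(3) that by auto
          qed
        qed (use ne w rh(4) in auto)
        then show ?thesis by simp
      qed
      then have "ball w0 r \<subseteq> Z"
        unfolding Z_def using rh(2,3) by (intro interior_maximal) auto
      then show False
        using w0 rh(1) centre_in_ball[of w0 r] by blast
    qed
    then show ?thesis
      using rh(1,2) by blast
  qed
  then have "open (\<Omega> - Z)"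
    by (simp add: open_contains_ball)
  moreover have "open Z"
    by (simp add: Z_def)
  moreover have "U \<subseteq> Z"
    unfolding Z_def using U by (intro interior_maximal) auto
  moreover have "Z \<subseteq> \<Omega>"
    unfolding Z_def using interior_subset by blast
  ultimately have "\<Omega> - Z = {}"
    using connectedD[OF \<Omega>(2), of Z "\<Omega> - Z"] U(2) by auto
  then have "kills_eigenspace M T A w" if "w \<in> \<Omega>" for w
    using that interior_subset unfolding Z_def by blast
  then show ?thesis
    using zero_if_kills_eigenspaces[OF cd A _ \<open>x \<in> M\<close>] by blast
qed

text \<open>Near a point \<open>w0\<close> of this set, \<open>cinner (h w) (h w0)\<close> is
  continuous in \<open>w\<close> and nonzero at \<open>w0\<close>, which keeps \<open>h w\<close>
  from vanishing.\<close>

lemma open_not_kills_eigenspace: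
  fixes A :: "'a::separable_chilbert_space \<Rightarrow> 'b::separable_chilbert_space"
  assumes cd: "cowen_douglas 1 \<Omega> M T" and \<Omega>: "open \<Omega>" and A: "bounded_clinear_on M N A"
  shows "open {w\<in>\<Omega>. \<not> kills_eigenspace M T A w}"
  unfolding open_contains_ball
proof
  fix w0 assume w0: "w0 \<in> {w\<in>\<Omega>. \<not> kills_eigenspace M T A w}"
  then have "w0 \<in> \<Omega>" by simp
  then obtain r and h :: "complex \<Rightarrow> 'b" where rh: "r > 0" "ball w0 r \<subseteq> \<Omega>"
    "\<forall>w\<in>ball w0 r. kills_eigenspace M T A w \<longleftrightarrow> h w = 0"
    "\<forall>y. (\<lambda>w. cinner (h w) y) holomorphic_on ball w0 r"
    using kills_eigenspace_locally[OF cd \<Omega> _ A] by blast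
  have "cinner (h w0) (h w0) \<noteq> 0"
    using rh(1,3) w0 by simp
  then obtain e where e: "e > 0"
    "\<And>w. w \<in> ball w0 r \<Longrightarrow> dist w0 w < e \<Longrightarrow> cinner (h w) (h w0) \<noteq> 0"
    using continuous_on_avoid[of "ball w0 r" "\<lambda>w. cinner (h w) (h w0)" w0 0] rh(1)
      holomorphic_on_imp_continuous_on[OF rh(4)[rule_format]] by auto
  have "ball w0 (min r e) \<subseteq> {w\<in>\<Omega>. \<not> kills_eigenspace M T A w}"
  proof
    fix w assume "w \<in> ball w0 (min r e)"
    then have "w \<in> ball w0 r" "dist w0 w < e" by auto
    then show "w \<in> {w\<in>\<Omega>. \<not> kills_eigenspace M T A w}"
      using rh(2,3) e(2)[of w] by auto
  qed
  then show "\<exists>e>0. ball w0 e \<subseteq> {w\<in>\<Omega>. \<not> kills_eigenspace M T A w}"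
    using rh(1) e(1) by (intro exI[of _ "min r e"]) auto
qed

section \<open>Intertwiners and commutators\<close>

definition nonzero_intertwiner ::
  "'a::separable_chilbert_space set \<Rightarrow> ('a \<Rightarrow> 'a) \<Rightarrow> 'b::separable_chilbert_space set \<Rightarrow> ('b \<Rightarrow> 'b) \<Rightarrow>
    ('a \<Rightarrow> 'b) \<Rightarrow> bool" where
  "nonzero_intertwiner M T N T' A \<longleftrightarrow>
     bounded_clinear_on M N A \<and> (\<forall>x\<in>M. A (T x) = T' (A x)) \<and> (\<exists>x\<in>M. A x \<noteq> 0)"

text \<open>Where \<open>A\<close> does not kill an eigenspace of \<open>T\<close>, it produces an
  eigenvector of \<open>T'\<close> with the same eigenvalue. If \<open>B \<circ> A\<close> were
  zero, \<open>B\<close> would kill that eigenspace. This happens on a nonempty open set, so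
  \<open>B\<close> would vanish by the identity theorem.\<close>

lemma nonzero_intertwiner_compose:
  assumes cd: "cowen_douglas 1 \<Omega> M T" and cd': "cowen_douglas 1 \<Omega> N T'"
    and \<Omega>: "open \<Omega>" "connected \<Omega>"
    and A: "nonzero_intertwiner M T N T' A" and B: "nonzero_intertwiner N T' L T'' B"
  shows "nonzero_intertwiner M T L T'' (B \<circ> A)"
proof -
  note M = cowen_douglasD(1)[OF cd]
  have Ab: "bounded_clinear_on M N A" and Bb: "bounded_clinear_on N L B"
    using A B by (auto simp: nonzero_intertwiner_def)
  have BA: "bounded_clinear_on M L (B \<circ> A)"
    by (rule bounded_clinear_on_compose[OF Ab Bb])
  have "\<exists>x\<in>M. (B \<circ> A) x \<noteq> 0"
  proof (rule ccontr)
    assume "\<not> ?thesis"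
    then have zero: "B (A x) = 0" if "x \<in> M" for x
      using that by auto
    let ?U = "{w\<in>\<Omega>. \<not> kills_eigenspace M T A w}"
    have "open ?U"
      by (rule open_not_kills_eigenspace[OF cd \<Omega>(1) Ab])
    moreover have "?U \<noteq> {}"
      using zero_if_kills_eigenspaces[OF cd Ab] A by (auto simp: nonzero_intertwiner_def)
    moreover have "kills_eigenspace N T' B w" if w: "w \<in> ?U" for w
    proof -
      obtain x where x: "x \<in> M" "T x = w *\<^sub>C x" "A x \<noteq> 0"
        using w unfolding kills_eigenspace_def by blast
      then have "T' (A x) = w *\<^sub>C A x"
        using A bounded_clinear_on_scaleC[OF M Ab x(1), of w]
        by (metis nonzero_intertwiner_def)
      then show ?thesis
        using kills_eigenspace_iff[OF cd' _ Bb] bounded_clinear_on_mem[OF M Ab] x zero w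
        by blast
    qed
    ultimately have "B y = 0" if "y \<in> N" for y
      using zero_if_kills_eigenspaces_open[OF cd' \<Omega> Bb, of ?U] that by blast
    then show False
      using B by (auto simp: nonzero_intertwiner_def)
  qed
  then show ?thesis
    using A B BA bounded_clinear_on_mem[OF M Ab] by (auto simp: nonzero_intertwiner_def)
qed

text \<open>The Kleinecke--Shirokov argument.  On an eigenvector \<open>v\<close> of \<open>T\<close> with eigenvalue \<open>w\<close> we have
  \<open>A v = \<phi> v\<close>, and with \<open>N = T - w\<close> it follows that \<open>N\<^sup>m X\<^sup>m v = m! (-\<phi>)\<^sup>m v\<close>, whose left-hand side
  grows only geometrically in \<open>m\<close>.\<close>

lemma commutator_eq_zero:
  assumes cd: "cowen_douglas 1 \<Omega> M T"
    and A: "bounded_clinear_on M M A" and AT: "\<And>x. x \<in> M \<Longrightarrow> A (T x) = T (A x)"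
    and X: "bounded_clinear_on M M X" and AX: "\<And>x. x \<in> M \<Longrightarrow> A x = X (T x) - T (X x)"
    and "x \<in> M"
  shows "A x = 0"
proof (rule zero_if_kills_eigenspaces[OF cd A _ \<open>x \<in> M\<close>], unfold kills_eigenspace_def, intro ballI impI)
  fix w v assume w: "w \<in> \<Omega>" and v: "v \<in> M" "T v = w *\<^sub>C v"
  show "A v = 0"
  proof (rule ccontr)
    assume "A v \<noteq> 0"
    note M = cowen_douglasD(1)[OF cd] and T = cowen_douglasD(2)[OF cd]
    have v0: "v \<noteq> 0"
      using \<open>A v \<noteq> 0\<close> bounded_clinear_on_zero[OF M A] by auto
    define N where "N x = T x - w *\<^sub>C x" for x
    have N: "bounded_clinear_on M M N"
      unfolding N_def by (rule bounded_clinear_on_diff_scaleC[OF M T])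
    have mem: "A x \<in> M" "T x \<in> M" "X x \<in> M" "N x \<in> M" if "x \<in> M" for x
      using bounded_clinear_on_mem[OF M A] bounded_clinear_on_mem[OF M T]
        bounded_clinear_on_mem[OF M X] bounded_clinear_on_mem[OF M N] that by auto
    have powN: "(N ^^ k) x \<in> M" if "x \<in> M" for k x
      using that by (induction k) (auto simp: mem)
    have powX: "(X ^^ k) x \<in> M" if "x \<in> M" for k x
      using that by (induction k) (auto simp: mem)
    have AN: "N (A x) = A (N x)" if "x \<in> M" for x
      using that AT closed_csubspaceD(6)[OF M]
      by (simp add: N_def bounded_clinear_on_diff[OF M A] bounded_clinear_on_scaleC[OF M A] mem)
    have NX: "N (X x) = X (N x) - A x" if "x \<in> M" for x
      using that closed_csubspaceD(6)[OF M]
      by (simp add: N_def AX bounded_clinear_on_diff[OF M X] bounded_clinear_on_scaleC[OF M X] mem)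
    \<comment> \<open>Since \<open>A\<close> commutes with \<open>N\<close>, moving \<open>X\<close>
      across \<open>N ^^ k\<close> costs \<open>k\<close> identical terms. At \<open>k = 0\<close>
      the truncated exponent \<open>k - 1\<close> is harmless because its coefficient is
      zero.\<close>
    have NkX: "(N ^^ k) (X x) = X ((N ^^ k) x) - of_nat k *\<^sub>C A ((N ^^ (k - 1)) x)"
      if x: "x \<in> M" for k x
    proof (induction k)
      case (Suc k)
      let ?y = "(N ^^ k) x" and ?z = "(N ^^ (k - 1)) x"
      have "(N ^^ Suc k) (X x) = N (X ?y - of_nat k *\<^sub>C A ?z)"
        using Suc by simp
      also have "\<dots> = N (X ?y) - of_nat k *\<^sub>C N (A ?z)"
        using powN[OF x] closed_csubspaceD(6)[OF M] mem
        by (simp add: bounded_clinear_on_diff[OF M N] bounded_clinear_on_scaleC[OF M N])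
      also have "of_nat k *\<^sub>C N (A ?z) = of_nat k *\<^sub>C A ?y"
        by (cases k) (auto simp: AN powN[OF x])
      also have "N (X ?y) = X (N ?y) - A ?y"
        by (rule NX[OF powN[OF x]])
      finally show ?case
        by (simp add: scaleC_add_left scaleC_one algebra_simps)
    qed simp
    obtain \<phi> where \<phi>: "A v = \<phi> *\<^sub>C v"
    proof (rule cowen_douglas_eigenvector_unique[OF cd w _ _ v v0])
      show "T (A v) = w *\<^sub>C A v"
        using AT[OF v(1)] v bounded_clinear_on_scaleC[OF M A v(1)] by simp
    qed (use mem v in auto)
    have \<phi>0: "\<phi> \<noteq> 0"
      using \<phi> \<open>A v \<noteq> 0\<close> by auto
    have Nv: "(N ^^ k) v = (if k = 0 then v else 0)" for k
    proof (cases k)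
      case (Suc j)
      have "(N ^^ j) 0 = 0" for j
        by (induction j) (simp_all add: bounded_clinear_on_zero[OF M N])
      moreover have "N v = 0"
        using v by (simp add: N_def)
      ultimately show ?thesis
        by (simp add: Suc funpow_Suc_right del: funpow.simps)
    qed simp
    \<comment> \<open>The case \<open>k > m\<close> is included because the induction step meets
      \<open>N ^^ k\<close> applied to a lower power of \<open>X\<close>, and that term has to
      vanish.\<close>
    have key: "(N ^^ k) ((X ^^ m) v) = (if k = m then (fact m * (- \<phi>) ^ m) *\<^sub>C v else 0)"
      if "k \<ge> m" for k m
      using that
    proof (induction m arbitrary: k)
      case 0
      then show ?case by (simp add: Nv scaleC_one)
    next
      case (Suc m)
      let ?x = "(X ^^ m) v"
      have "(N ^^ k) ((X ^^ Suc m) v) = X ((N ^^ k) ?x) - of_nat k *\<^sub>C A ((N ^^ (k - 1)) ?x)"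
        using NkX[OF powX[OF v(1)]] by simp
      also have "(N ^^ k) ?x = 0"
        using Suc.IH[of k] Suc.prems by simp
      also have "(N ^^ (k - 1)) ?x = (if k = Suc m then (fact m * (- \<phi>) ^ m) *\<^sub>C v else 0)"
        using Suc.IH[of "k - 1"] Suc.prems by auto
      finally show ?case
        using bounded_clinear_on_zero[OF M X] bounded_clinear_on_zero[OF M A]
        by (simp add: bounded_clinear_on_scaleC[OF M A v(1)] \<phi> scaleC_scaleC algebra_simps
            flip: complex_vector.scale_minus_left)
    qed
    obtain K where K: "K > 0" "\<And>x. x \<in> M \<Longrightarrow> norm (N x) \<le> K * norm x"
      using bounded_clinear_on_bound[OF M N] by blast
    obtain L where L: "L > 0" "\<And>x. x \<in> M \<Longrightarrow> norm (X x) \<le> L * norm x"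
      using bounded_clinear_on_bound[OF M X] by blast
    have pow_bound: "norm ((F ^^ k) x) \<le> C ^ k * norm x"
      if "x \<in> M" "C > 0" "\<And>x. x \<in> M \<Longrightarrow> F x \<in> M" "\<And>x. x \<in> M \<Longrightarrow> norm (F x) \<le> C * norm x"
      for F :: "'a \<Rightarrow> 'a" and C k x
    proof -
      have "(F ^^ k) x \<in> M \<and> norm ((F ^^ k) x) \<le> C ^ k * norm x"
      proof (induction k)
        case (Suc k)
        have "norm (F ((F ^^ k) x)) \<le> C * norm ((F ^^ k) x)"
          using that(4) Suc by blast
        also have "\<dots> \<le> C * (C ^ k * norm x)"
          using Suc that(2) by (intro mult_left_mono) auto
        finally show ?case
          using that(3) Suc by simp
      qed (use that in simp)
      then show ?thesis ..
    qed
    define c where "c = K * L / cmod \<phi>"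
    have fact_le: "fact m \<le> c ^ m" for m
    proof -
      have "fact m * cmod \<phi> ^ m * norm v = norm ((N ^^ m) ((X ^^ m) v))"
        using key[of m m] by (simp add: norm_scaleC norm_mult norm_power)
      also have "\<dots> \<le> K ^ m * norm ((X ^^ m) v)"
        by (rule pow_bound[OF powX[OF v(1)] K(1) mem(4) K(2)])
      also have "\<dots> \<le> K ^ m * (L ^ m * norm v)"
        using K(1) pow_bound[OF v(1) L(1) mem(3) L(2)] by (intro mult_left_mono) auto
      finally have "fact m * cmod \<phi> ^ m \<le> (K * L) ^ m"
        using v0 by (simp add: power_mult_distrib mult.assoc[symmetric])
      then show ?thesis
        using \<phi>0 by (simp add: c_def power_divide pos_le_divide_eq)
    qed
    \<comment> \<open>The terms of the exponential series tend to zero, so factorials eventually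
      exceed the powers of \<open>c\<close>.\<close>
    have "(\<lambda>m. inverse (fact m) * c ^ m) \<longlonglongrightarrow> 0"
      by (rule summable_LIMSEQ_zero[OF summable_exp])
    then have "\<forall>\<^sub>F m in sequentially. inverse (fact m) * c ^ m < 1"
      by (rule order_tendstoD) simp
    then obtain m where "inverse (fact m) * c ^ m < 1"
      by (auto simp: eventually_sequentially)
    then have "c ^ m < fact m"
      by (simp add: field_simps)
    then show False
      using fact_le[of m] by simp
  qed
qed

section \<open>Flags and their intertwining operators\<close>

text \<open>Two candidates for the projection differ by a vector of \<open>M\<close> that is
  orthogonal to itself.\<close>

lemma cproj_eqI:
  assumes M: "closed_csubspace M" and "y \<in> M" "\<And>z. z \<in> M \<Longrightarrow> cinner (x - y) z = 0"
  shows "cproj M x = y"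
  unfolding cproj_def
proof (rule the_equality)
  fix y' assume y': "y' \<in> M \<and> (\<forall>z\<in>M. cinner (x - y') z = 0)"
  then have "y' - y \<in> M"
    using assms closed_csubspaceD(5)[OF M] by blast
  then have "cinner (x - y) (y' - y) - cinner (x - y') (y' - y) = 0"
    using assms(3) y' by simp
  then have "cinner (y' - y) (y' - y) = 0"
    by (simp flip: cinner_diff_left)
  then show "y' = y" by simp
qed (use assms in blast)

section \<open>Orthogonal decompositions and blocks of operators\<close>

locale decomposition =
  fixes n :: nat and H :: "nat \<Rightarrow> 'a::separable_chilbert_space set"
  assumes od: "orthogonal_decomposition n H"
begin

lemma closed_csubspace: "i < n \<Longrightarrow> closed_csubspace (H i)"
  using od by (simp add: orthogonal_decomposition_def)

lemma orthogonal: "i < n \<Longrightarrow> j < n \<Longrightarrow> i \<noteq> j \<Longrightarrow> x \<in> H i \<Longrightarrow> y \<in> H j \<Longrightarrow> cinner x y = 0"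
  using od by (simp add: orthogonal_decomposition_def)

text \<open>Supplies the existence behind the definite description \<open>cproj\<close>: without its
  \<open>i\<close>-th term, the sum is orthogonal to \<open>H i\<close>.\<close>

lemma cproj_sum:
  assumes f: "\<And>i. i < n \<Longrightarrow> f i \<in> H i" and i: "i < n"
  shows "cproj (H i) (\<Sum>i<n. f i) = f i"
proof (rule cproj_eqI[OF closed_csubspace[OF i] f[OF i]])
  fix z assume z: "z \<in> H i"
  have "(\<Sum>j<n. f j) - f i = (\<Sum>j\<in>{..<n} - {i}. f j)"
    using i by (simp add: sum_diff1)
  then show "cinner ((\<Sum>j<n. f j) - f i) z = 0"
    using orthogonal[OF _ i _ f z] by (simp add: cinner_sum_left)
qed

lemma components:
  obtains f where "\<And>i. i < n \<Longrightarrow> f i \<in> H i" "x = (\<Sum>i<n. f i)"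
    "\<And>i. i < n \<Longrightarrow> cproj (H i) x = f i"
proof -
  obtain f where f: "\<And>i. i < n \<Longrightarrow> f i \<in> H i" "x = (\<Sum>i<n. f i)"
    using od unfolding orthogonal_decomposition_def by metis
  with that[of f] cproj_sum[of f] show thesis by simp
qed

lemma cproj_mem: "i < n \<Longrightarrow> cproj (H i) x \<in> H i"
  by (rule components[of x]) simp

lemma sum_cproj: "(\<Sum>i<n. cproj (H i) x) = x"
  by (rule components[of x]) (metis (no_types, lifting) lessThan_iff sum.cong)

lemma cproj_component:
  assumes x: "x \<in> H j" and ij: "i < n" "j < n"
  shows "cproj (H i) x = (if i = j then x else 0)"
proof -
  have "(\<Sum>k<n. if k = j then x else 0) = x"
    using ij by simp
  then show ?thesis
    using cproj_sum[of "\<lambda>k. if k = j then x else 0" i] x ij closed_csubspaceD(3)[OF closed_csubspace]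
    by auto
qed

lemma cproj_add: "i < n \<Longrightarrow> cproj (H i) (x + y) = cproj (H i) x + cproj (H i) y"
  using cproj_sum[of "\<lambda>i. cproj (H i) x + cproj (H i) y" i] cproj_mem
    closed_csubspaceD(4)[OF closed_csubspace]
  by (simp add: sum.distrib sum_cproj)

lemma cproj_scaleC: "i < n \<Longrightarrow> cproj (H i) (c *\<^sub>C x) = c *\<^sub>C cproj (H i) x"
  using cproj_sum[of "\<lambda>i. c *\<^sub>C cproj (H i) x" i] cproj_mem
    closed_csubspaceD(6)[OF closed_csubspace]
  by (simp add: sum_cproj flip: complex_vector.scale_sum_right)

lemma cinner_cproj:
  assumes "i < n" "z \<in> H i"
  shows "cinner x z = cinner (cproj (H i) x) z"
proof -
  have "cinner x z = (\<Sum>j<n. cinner (cproj (H j) x) z)"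
    by (simp add: sum_cproj flip: cinner_sum_left)
  also have "\<dots> = (\<Sum>j<n. if j = i then cinner (cproj (H j) x) z else 0)"
    using orthogonal[OF _ assms(1) _ cproj_mem assms(2)] by (intro sum.cong) auto
  finally show ?thesis
    using assms by simp
qed

lemma cinner_eq_sum: "cinner x y = (\<Sum>i<n. cinner (cproj (H i) x) (cproj (H i) y))"
proof -
  have "cinner x y = (\<Sum>i<n. cinner x (cproj (H i) y))"
    by (simp add: sum_cproj flip: cinner_sum_right)
  also have "\<dots> = (\<Sum>i<n. cinner (cproj (H i) x) (cproj (H i) y))"
    by (intro sum.cong cinner_cproj refl cproj_mem) auto
  finally show ?thesis .
qed

lemma norm_cproj_le:
  assumes "i < n"
  shows "norm (cproj (H i) x) \<le> norm x"
proof -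
  let ?p = "cproj (H i) x"
  have "complex_of_real ((norm ?p)\<^sup>2) = cinner x ?p"
    using cinner_cproj[OF assms cproj_mem[OF assms, of x], of x] by (simp add: cinner_self)
  then have "(norm ?p)\<^sup>2 = cmod (cinner x ?p)"
    by (metis norm_of_real abs_of_nonneg zero_le_power2)
  also have "\<dots> \<le> norm x * norm ?p"
    by (rule cmod_cinner_le)
  finally show ?thesis
    by (cases "norm ?p = 0") (simp_all add: power2_eq_square)
qed

lemma bounded_clinear_on_cproj: "i < n \<Longrightarrow> bounded_clinear_on UNIV (H i) (cproj (H i))"
  unfolding bounded_clinear_on_def
  using cproj_mem cproj_add cproj_scaleC norm_cproj_le by (auto intro!: exI[of _ 1])

lemma bounded_clinear_on_block:
  assumes X: "bounded_clinear_on UNIV UNIV X" and i: "i < n"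
  shows "bounded_clinear_on M (H i) (\<lambda>x. cproj (H i) (X x))"
  using bounded_clinear_on_subset[OF bounded_clinear_on_compose[OF X bounded_clinear_on_cproj[OF i]],
      of M "H i"] cproj_mem[OF i]
  by (auto simp: comp_def)

lemma operator_eq_sum:
  assumes "bounded_clinear_on UNIV UNIV X"
  shows "X x = (\<Sum>m<n. X (cproj (H m) x))"
  using bounded_clinear_on_sum[OF closed_csubspace_UNIV assms, of "{..<n}" "\<lambda>m. cproj (H m) x"]
  by (simp add: sum_cproj)

lemma cproj_sum_right: "i < n \<Longrightarrow> cproj (H i) (sum f I) = (\<Sum>k\<in>I. cproj (H i) (f k))"
  using bounded_clinear_on_sum[OF closed_csubspace_UNIV bounded_clinear_on_cproj, of i I f] by simp

lemma cproj_zero: "i < n \<Longrightarrow> cproj (H i) 0 = 0"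
  using cproj_sum_right[of i "\<lambda>_. 0" "{}"] by simp

lemma eqI: "(\<And>i. i < n \<Longrightarrow> cproj (H i) x = cproj (H i) y) \<Longrightarrow> x = y"
  by (subst (1 2) sum_cproj[symmetric]) (rule sum.cong, auto)

end

section \<open>Rows and columns of one flag operator\<close>

locale flag = decomposition n H
  for n :: nat and H :: "nat \<Rightarrow> 'a::separable_chilbert_space set" +
  fixes \<Omega> :: "complex set" and T :: "'a \<Rightarrow> 'a" and D :: "nat \<Rightarrow> 'a \<Rightarrow> 'a"
    and S :: "nat \<Rightarrow> nat \<Rightarrow> 'a \<Rightarrow> 'a"
  assumes \<Omega>: "open \<Omega>" "connected \<Omega>" "\<Omega> \<noteq> {}"
    and T: "bounded_clinear_on UNIV UNIV T"
    and fd: "flag_decomposition n \<Omega> T H D S"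
begin

lemma cd: "i < n \<Longrightarrow> cowen_douglas 1 \<Omega> (H i) (D i)"
  using fd by (simp add: flag_decomposition_def)

lemma D_mem: "i < n \<Longrightarrow> x \<in> H i \<Longrightarrow> D i x \<in> H i"
  using cowen_douglasD(1,2)[OF cd] bounded_clinear_on_mem by blast

lemma S_mem: "i < j \<Longrightarrow> j < n \<Longrightarrow> x \<in> H j \<Longrightarrow> S i j x \<in> H i"
  using fd bounded_clinear_on_mem[OF closed_csubspace, of j "H i" "S i j" x]
  by (simp add: flag_decomposition_def)

lemma nontrivial: "i < n \<Longrightarrow> \<exists>x\<in>H i. x \<noteq> 0"
  using \<Omega>(3)[folded ex_in_conv] cowen_douglas_ex_eigenvector[OF cd[of i]] by blast

lemma T_block:
  assumes "x \<in> H j" "i < n" "j < n"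
  shows "cproj (H i) (T x) = (if i < j then S i j x else if i = j then D j x else 0)"
  using fd assms by (auto simp: flag_decomposition_def block_upper_triangular_def)

lemma T_row:
  assumes "i < n"
  shows "cproj (H i) (T z) = (\<Sum>m<n. cproj (H i) (T (cproj (H m) z)))"
  by (subst operator_eq_sum[OF T]) (rule cproj_sum_right[OF assms])

lemma T_column:
  assumes "x \<in> H j" "j < n"
  shows "T x = D j x + (\<Sum>m<j. S m j x)"
proof -
  have "T x = (\<Sum>m<n. cproj (H m) (T x))"
    by (simp add: sum_cproj)
  also have "\<dots> = (\<Sum>m<Suc j. cproj (H m) (T x))"
    using assms by (intro sum.mono_neutral_right) (auto simp: T_block)
  also have "\<dots> = D j x + (\<Sum>m<j. S m j x)"
    using assms by (simp add: T_block add.commute)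
  finally show ?thesis .
qed

text \<open>Entries of row \<open>k\<close> left of the diagonal are zero, and those to the right
  meet vanishing components of \<open>z\<close>.\<close>

lemma T_row_diag:
  assumes "k < n" "\<And>m. k < m \<Longrightarrow> m < n \<Longrightarrow> cproj (H m) z = 0"
  shows "cproj (H k) (T z) = D k (cproj (H k) z)"
proof -
  have "(\<Sum>m<n. cproj (H k) (T (cproj (H m) z))) = (\<Sum>m\<in>{k}. cproj (H k) (T (cproj (H m) z)))"
  proof (rule sum.mono_neutral_right)
    show "\<forall>m\<in>{..<n} - {k}. cproj (H k) (T (cproj (H m) z)) = 0"
    proof
      fix m assume m: "m \<in> {..<n} - {k}"
      show "cproj (H k) (T (cproj (H m) z)) = 0"
      proof (cases "m < k")
        case True
        then show ?thesis
          using m assms(1) by (simp add: T_block[OF cproj_mem])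
      next
        case False
        then show ?thesis
          using m assms(2)[of m] bounded_clinear_on_zero[OF closed_csubspace_UNIV T]
            cproj_zero[OF assms(1)]
          by simp
      qed
    qed
  qed (use assms in auto)
  with T_row[OF assms(1), of z] show ?thesis
    using T_block[OF cproj_mem] assms(1) by simp
qed

text \<open>When \<open>z\<close> reaches one step further down, exactly one off-diagonal term
  survives, and it involves the superdiagonal entry, which is an intertwiner.\<close>

lemma T_row_superdiag:
  assumes k: "Suc k < n" and zero: "\<And>m. Suc k < m \<Longrightarrow> m < n \<Longrightarrow> cproj (H m) z = 0"
  shows "cproj (H k) (T z) = D k (cproj (H k) z) + S k (Suc k) (cproj (H (Suc k)) z)"
proof -
  have k': "k < n"
    using k by simp
  have "(\<Sum>m<n. cproj (H k) (T (cproj (H m) z))) =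
      (\<Sum>m\<in>{k, Suc k}. cproj (H k) (T (cproj (H m) z)))"
  proof (rule sum.mono_neutral_right)
    show "\<forall>m\<in>{..<n} - {k, Suc k}. cproj (H k) (T (cproj (H m) z)) = 0"
    proof
      fix m assume m: "m \<in> {..<n} - {k, Suc k}"
      show "cproj (H k) (T (cproj (H m) z)) = 0"
      proof (cases "m < k")
        case True
        then show ?thesis
          using m k by (simp add: T_block[OF cproj_mem])
      next
        case False
        then show ?thesis
          using m zero[of m] bounded_clinear_on_zero[OF closed_csubspace_UNIV T] cproj_zero[OF k']
          by simp
      qed
    qed
  qed (use k in auto)
  with T_row[OF k', of z] show ?thesis
    using T_block[OF cproj_mem] k by simp
qed

lemma superdiag_intertwiner:
  assumes "Suc k < n"
  shows "nonzero_intertwiner (H (Suc k)) (D (Suc k)) (H k) (D k) (S k (Suc k))"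
  using fd assms by (auto simp: flag_decomposition_def nonzero_intertwiner_def)

lemma ident_intertwiner: "i < n \<Longrightarrow> nonzero_intertwiner (H i) (D i) (H i) (D i) (\<lambda>x. x)"
  using nontrivial by (auto simp: nonzero_intertwiner_def bounded_clinear_on_ident)

text \<open>Compose the superdiagonal entries from \<open>l\<close> down to \<open>j\<close>;
  products of nonzero intertwiners remain nonzero.\<close>

lemma ex_intertwiner_down:
  assumes "j \<le> l" "l < n"
  shows "\<exists>B. nonzero_intertwiner (H l) (D l) (H j) (D j) B"
  using assms
proof (induction l rule: dec_induct)
  case base
  then show ?case using ident_intertwiner by blast
next
  case (step l)
  then obtain B where "nonzero_intertwiner (H l) (D l) (H j) (D j) B" by auto
  then show ?case
    using nonzero_intertwiner_compose[OF cd cd \<Omega>(1,2) superdiag_intertwiner] step by (metis Suc_lessD)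
qed

end

section \<open>Two flags joined by an invertible intertwiner\<close>

locale flag_intertwining =
  F: flag n H \<Omega> T D S + G: flag n H' \<Omega> T' D' S'
  for n :: nat and \<Omega> :: "complex set"
    and H :: "nat \<Rightarrow> 'a::separable_chilbert_space set" and T D S
    and H' :: "nat \<Rightarrow> 'b::separable_chilbert_space set" and T' D' S' +
  fixes X :: "'a \<Rightarrow> 'b" and Y :: "'b \<Rightarrow> 'a"
  assumes X: "bounded_clinear_on UNIV UNIV X" and Y: "bounded_clinear_on UNIV UNIV Y"
    and XT: "X (T x) = T' (X x)"
    and YX: "Y (X x) = x" and XY: "X (Y y) = y"
begin

text \<open>Makes every result on the columns of \<open>X\<close> available for its inverse
  \<open>Y\<close>.\<close>

lemma flip: "flag_intertwining n \<Omega> H' T' D' S' H T D S Y X"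
proof unfold_locales
  show "Y (T' y) = T (Y y)" for y
    by (metis XT YX XY)
qed (fact X Y YX XY)+

abbreviation triangular_column :: "nat \<Rightarrow> bool" where
  "triangular_column m \<equiv> \<forall>i. m < i \<longrightarrow> i < n \<longrightarrow> (\<forall>x\<in>H m. cproj (H' i) (X x) = 0)"

text \<open>\<open>T x\<close> is \<open>D j x\<close> plus terms in \<open>H m\<close> with
  \<open>m < j\<close>. By triangularity of those columns, \<open>X\<close> sends these terms to
  vectors without components in rows \<open>k \<ge> j\<close>.\<close>

lemma block_T:
  assumes cols: "\<And>m. m < j \<Longrightarrow> triangular_column m" and "x \<in> H j" "j \<le> k" "k < n"
  shows "cproj (H' k) (T' (X x)) = cproj (H' k) (X (D j x))"
proof -
  have "j < n" using assms by simp
  have "X (T x) = X (D j x) + (\<Sum>m<j. X (S m j x))"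
    unfolding F.T_column[OF \<open>x \<in> H j\<close> \<open>j < n\<close>]
    by (simp add: bounded_clinear_on_add[OF closed_csubspace_UNIV X]
        bounded_clinear_on_sum[OF closed_csubspace_UNIV X])
  moreover have "cproj (H' k) (X (S m j x)) = 0" if "m < j" for m
    using cols[OF that] F.S_mem[OF that \<open>j < n\<close> \<open>x \<in> H j\<close>] assms that by auto
  ultimately show ?thesis
    using \<open>k < n\<close> by (simp add: G.cproj_add G.cproj_sum_right flip: XT)
qed

text \<open>Compare the entries \<open>(k, j)\<close> of both sides of \<open>X T = T' X\<close>. As
  nothing of column \<open>j\<close> lies below row \<open>k\<close>, only the diagonal entry
  \<open>D' k\<close> acts on the right.\<close>

lemma bottom_block_intertwiner:
  assumes "\<And>m. m < j \<Longrightarrow> triangular_column m" "j \<le> k" "k < n"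
    and "\<And>i x. k < i \<Longrightarrow> i < n \<Longrightarrow> x \<in> H j \<Longrightarrow> cproj (H' i) (X x) = 0"
    and "\<exists>x\<in>H j. cproj (H' k) (X x) \<noteq> 0"
  shows "nonzero_intertwiner (H j) (D j) (H' k) (D' k) (\<lambda>x. cproj (H' k) (X x))"
  using block_T[OF assms(1) _ assms(2,3)] G.T_row_diag[OF \<open>k < n\<close>] assms
    G.bounded_clinear_on_block[OF X \<open>k < n\<close>]
  by (auto simp: nonzero_intertwiner_def)

lemma ex_bottom_block:
  assumes "\<exists>k. j \<le> k \<and> k < n \<and> (\<exists>x\<in>H j. cproj (H' k) (X x) \<noteq> 0)"
  shows "\<exists>k. j \<le> k \<and> k < n \<and> (\<exists>x\<in>H j. cproj (H' k) (X x) \<noteq> 0) \<and>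
    (\<forall>i x. k < i \<longrightarrow> i < n \<longrightarrow> x \<in> H j \<longrightarrow> cproj (H' i) (X x) = 0)"
proof -
  define P where "P k \<longleftrightarrow> j \<le> k \<and> k < n \<and> (\<exists>x\<in>H j. cproj (H' k) (X x) \<noteq> 0)" for k
  obtain k0 where "P k0"
    using assms unfolding P_def by blast
  moreover have bound: "k \<le> n" if "P k" for k
    using that by (simp add: P_def)
  ultimately have P: "P (Greatest P)"
    by (rule GreatestI_nat)
  have "cproj (H' i) (X x) = 0" if "Greatest P < i" "i < n" "x \<in> H j" for i x
  proof (rule ccontr)
    assume "cproj (H' i) (X x) \<noteq> 0"
    then have "P i"
      using that P by (auto simp: P_def)
    then have "i \<le> Greatest P"
      using bound by (rule Greatest_le_nat)
    then show False
      using that by simp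
  qed
  then show ?thesis
    using P unfolding P_def by blast
qed

text \<open>As \<open>Y\<close> inverts \<open>X\<close> and both preserve the first \<open>j\<close> steps of the flags, \<open>X\<close> does not map
  \<open>H j\<close> into the span of \<open>H' 0, \<dots>, H' (j - 1)\<close>.\<close>

lemma ex_intertwiner_across:
  assumes cols: "\<And>m. m < j \<Longrightarrow> triangular_column m"
    and cols': "\<And>m i y. m < j \<Longrightarrow> m < i \<Longrightarrow> i < n \<Longrightarrow> y \<in> H' m \<Longrightarrow> cproj (H i) (Y y) = 0"
    and "j < n"
  shows "\<exists>B. nonzero_intertwiner (H j) (D j) (H' j) (D' j) B"
proof -
  have "\<exists>k. j \<le> k \<and> k < n \<and> (\<exists>x\<in>H j. cproj (H' k) (X x) \<noteq> 0)"
  proof (rule ccontr)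
    assume no: "\<not> ?thesis"
    obtain x where x: "x \<in> H j" "x \<noteq> 0"
      using F.nontrivial[OF \<open>j < n\<close>] by blast
    have "x = Y (X x)"
      by (simp add: YX)
    also have "\<dots> = (\<Sum>m<n. Y (cproj (H' m) (X x)))"
      by (rule G.operator_eq_sum[OF Y])
    also have "cproj (H j) \<dots> = (\<Sum>m<n. cproj (H j) (Y (cproj (H' m) (X x))))"
      by (rule F.cproj_sum_right[OF \<open>j < n\<close>])
    \<comment> \<open>Terms with \<open>m < j\<close> vanish by triangularity of \<open>Y\<close>,
      the others because \<open>X x\<close> is assumed to have no component in row \<open>j\<close>
      or below.\<close>
    also have "\<dots> = 0"
    proof (rule sum.neutral, rule ballI)
      fix m assume m: "m \<in> {..<n}"
      show "cproj (H j) (Y (cproj (H' m) (X x))) = 0"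
      proof (cases "m < j")
        case True
        then show ?thesis
          using cols' G.cproj_mem \<open>j < n\<close> m by auto
      next
        case False
        then have "cproj (H' m) (X x) = 0"
          using no m x(1) by (metis lessThan_iff not_less)
        then show ?thesis
          using F.cproj_zero[OF \<open>j < n\<close>] bounded_clinear_on_zero[OF closed_csubspace_UNIV Y] by simp
      qed
    qed
    finally show False
      using x F.cproj_component[OF x(1) \<open>j < n\<close> \<open>j < n\<close>] by simp
  qed
  then obtain k where k: "j \<le> k" "k < n" "\<exists>x\<in>H j. cproj (H' k) (X x) \<noteq> 0"
    "\<forall>i x. k < i \<longrightarrow> i < n \<longrightarrow> x \<in> H j \<longrightarrow> cproj (H' i) (X x) = 0"
    using ex_bottom_block by blast
  have "nonzero_intertwiner (H j) (D j) (H' k) (D' k) (\<lambda>x. cproj (H' k) (X x))"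
    by (rule bottom_block_intertwiner[OF cols k(1,2) k(4)[rule_format] k(3)])
  moreover obtain B where "nonzero_intertwiner (H' k) (D' k) (H' j) (D' j) B"
    using G.ex_intertwiner_down k by blast
  ultimately show ?thesis
    using nonzero_intertwiner_compose[OF F.cd[OF \<open>j < n\<close>] G.cd[OF \<open>k < n\<close>] F.\<Omega>(1,2)] by blast
qed

text \<open>With \<open>k = Suc p\<close> the lowest nonzero row, row \<open>p\<close> of
  \<open>X T = T' X\<close> reads \<open>s = X\<^sub>p\<^sub>j D\<^sub>j - D'\<^sub>p
  X\<^sub>p\<^sub>j\<close>, where \<open>s = S'\<^sub>p\<^sub>k X\<^sub>k\<^sub>j\<close> is
  nonzero. An intertwiner \<open>C\<close> back to \<open>H j\<close> turns this into a nonzero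
  commutator with \<open>D j\<close> that also commutes with \<open>D j\<close>.\<close>

lemma triangular_column_step:
  assumes cols: "\<And>m. m < j \<Longrightarrow> triangular_column m"
    and cols': "\<And>m i y. m < j \<Longrightarrow> m < i \<Longrightarrow> i < n \<Longrightarrow> y \<in> H' m \<Longrightarrow> cproj (H i) (Y y) = 0"
    and "j < n"
  shows "triangular_column j"
proof (rule ccontr)
  assume "\<not> triangular_column j"
  then have "\<exists>i. j < i \<and> i < n \<and> (\<exists>x\<in>H j. cproj (H' i) (X x) \<noteq> 0)"
    by blast
  then obtain i where i: "j < i" "i < n" "\<exists>x\<in>H j. cproj (H' i) (X x) \<noteq> 0"
    by blast
  then have "\<exists>k. j \<le> k \<and> k < n \<and> (\<exists>x\<in>H j. cproj (H' k) (X x) \<noteq> 0)"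
    by (intro exI[of _ i]) simp
  then obtain k where k: "j \<le> k" "k < n" "\<exists>x\<in>H j. cproj (H' k) (X x) \<noteq> 0"
    "\<forall>i x. k < i \<longrightarrow> i < n \<longrightarrow> x \<in> H j \<longrightarrow> cproj (H' i) (X x) = 0"
    using ex_bottom_block by blast
  have "j < k"
    using i k by (metis le_less_trans not_le)
  then obtain p where p: "k = Suc p" "j \<le> p"
    by (cases k) auto
  have pn: "p < n" "Suc p < n"
    using k p by auto
  note cdj = F.cd[OF \<open>j < n\<close>] and cdp = G.cd[OF pn(1)] and cdk = G.cd[OF k(2)]
  note compose = nonzero_intertwiner_compose[OF _ _ F.\<Omega>(1,2)]
  have A: "nonzero_intertwiner (H j) (D j) (H' p) (D' p) (S' p k \<circ> (\<lambda>x. cproj (H' k) (X x)))"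
    using compose[OF cdj cdk bottom_block_intertwiner[OF cols k(1,2) k(4)[rule_format] k(3)]]
      G.superdiag_intertwiner[OF pn(2)] p(1) by blast
  \<comment> \<open>The way back from \<open>H' p\<close> first descends to index \<open>j\<close>
    within the second flag and then crosses to \<open>H j\<close>; the crossing is available at
    \<open>j\<close> because all earlier columns are triangular in both directions.\<close>
  obtain C1 where C1: "nonzero_intertwiner (H' p) (D' p) (H' j) (D' j) C1"
    using G.ex_intertwiner_down[OF p(2) pn(1)] by blast
  interpret flip: flag_intertwining n \<Omega> H' T' D' S' H T D S Y X
    by (rule flip)
  obtain C2 where C2: "nonzero_intertwiner (H' j) (D' j) (H j) (D j) C2"
    using flip.ex_intertwiner_across[of j] cols cols' \<open>j < n\<close> by blast
  define C where "C = C2 \<circ> C1"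
  have C: "nonzero_intertwiner (H' p) (D' p) (H j) (D j) C"
    unfolding C_def by (rule compose[OF cdp G.cd[OF \<open>j < n\<close>] C1 C2])
  have Cb: "bounded_clinear_on (H' p) (H j) C"
    using C by (simp add: nonzero_intertwiner_def)
  define Z where "Z = C \<circ> (S' p k \<circ> (\<lambda>x. cproj (H' k) (X x)))"
  have Z: "nonzero_intertwiner (H j) (D j) (H j) (D j) Z"
    unfolding Z_def by (rule compose[OF cdj cdp A C])
  \<comment> \<open>The block \<open>(p, j)\<close> of \<open>X\<close>, carried back to
    \<open>H j\<close>. Its failure to commute with \<open>D j\<close> is exactly
    \<open>Z\<close>.\<close>
  define W where "W = C \<circ> (\<lambda>x. cproj (H' p) (X x))"
  have W: "bounded_clinear_on (H j) (H j) W"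
    unfolding W_def
    by (rule bounded_clinear_on_compose[OF G.bounded_clinear_on_block[OF X pn(1)] Cb])
  have ZW: "Z x = W (D j x) - D j (W x)" if x: "x \<in> H j" for x
  proof -
    let ?s = "S' p k (cproj (H' k) (X x))" and ?q = "cproj (H' p) (X x)"
    have q: "?q \<in> H' p"
      by (rule G.cproj_mem[OF pn(1)])
    have "cproj (H' p) (X (D j x)) = cproj (H' p) (T' (X x))"
      by (rule block_T[OF cols x p(2) pn(1), symmetric])
    also have "\<dots> = D' p ?q + ?s"
      using G.T_row_superdiag[OF pn(2)] k(4) x p(1) by simp
    finally have "?s = cproj (H' p) (X (D j x)) - D' p ?q"
      by simp
    moreover have "C (D' p ?q) = D j (C ?q)"
      using C q by (simp add: nonzero_intertwiner_def)
    ultimately show ?thesis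
      using bounded_clinear_on_diff[OF G.closed_csubspace[OF pn(1)] Cb] G.cproj_mem[OF pn(1)]
        G.D_mem[OF pn(1) q]
      by (simp add: Z_def W_def)
  qed
  have "Z x = 0" if "x \<in> H j" for x
    using commutator_eq_zero[OF cdj _ _ W ZW that] Z by (simp add: nonzero_intertwiner_def)
  then show False
    using Z by (auto simp: nonzero_intertwiner_def)
qed

text \<open>The induction treats \<open>X\<close> and \<open>Y\<close> simultaneously, since each
  step needs the earlier columns of both.\<close>

theorem triangular: "m < n \<Longrightarrow> triangular_column m"
proof -
  interpret flip: flag_intertwining n \<Omega> H' T' D' S' H T D S Y X
    by (rule flip)
  have "m < n \<longrightarrow> triangular_column m \<and> flip.triangular_column m" for m
  proof (induction m rule: less_induct)
    case (less m)
    show ?case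
    proof
      assume m: "m < n"
      have "triangular_column l" "flip.triangular_column l" if "l < m" for l
        using less.IH[OF that] m that by auto
      then show "triangular_column m \<and> flip.triangular_column m"
        using triangular_column_step[of m] flip.triangular_column_step[of m] m by blast
    qed
  qed
  then show "m < n \<Longrightarrow> triangular_column m" by blast
qed

end

section \<open>Unitary intertwining operators\<close>

lemma unitary_onD:
  assumes "unitary_on M N U"
  shows "bounded_clinear_on M N U" "U ` M = N"
    and "x \<in> M \<Longrightarrow> y \<in> M \<Longrightarrow> cinner (U x) (U y) = cinner x y"
  using assms by (auto simp: unitary_on_def)

lemma unitary_on_inj:
  assumes M: "closed_csubspace M" and U: "unitary_on M N U"
    and x: "x \<in> M" and y: "y \<in> M" and eq: "U x = U y"
  shows "x = y"
proof -
  have d: "x - y \<in> M"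
    using closed_csubspaceD(5)[OF M x y] .
  have "U (x - y) = 0"
    using bounded_clinear_on_diff[OF M unitary_onD(1)[OF U] x y] eq by simp
  then have "cinner (x - y) (x - y) = 0"
    using unitary_onD(3)[OF U d d] by simp
  then show ?thesis by simp
qed

text \<open>By isometry \<open>z\<close> itself satisfies the condition that defines the adjoint at
  \<open>U z\<close>. This converts equations with adjoints into intertwining relations.\<close>

lemma cadjoint_on_unitary:
  assumes M: "closed_csubspace M" and U: "unitary_on M N U" and z: "z \<in> M"
  shows "cadjoint_on M U (U z) = z"
  unfolding cadjoint_on_def
proof (rule the_equality)
  show "z \<in> M \<and> (\<forall>x\<in>M. cinner (U x) (U z) = cinner x z)"
    using z unitary_onD(3)[OF U] by blast
next
  fix z' assume z': "z' \<in> M \<and> (\<forall>x\<in>M. cinner (U x) (U z) = cinner x z')"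
  then have d: "z' - z \<in> M"
    using closed_csubspaceD(5)[OF M _ z] by blast
  then have "cinner (z' - z) z' = cinner (z' - z) z"
    using z' unitary_onD(3)[OF U d z] by simp
  then have "cinner (z' - z) (z' - z) = 0"
    by (simp add: cinner_diff_right)
  then show "z' = z" by simp
qed

text \<open>Linearity of the inverse follows by applying the injective \<open>U\<close> to both
  sides.\<close>

lemma unitary_inverse:
  assumes U: "unitary_on UNIV UNIV U"
  shows "\<exists>Y. unitary_on UNIV UNIV Y \<and> (\<forall>x. Y (U x) = x) \<and> (\<forall>y. U (Y y) = y)"
proof -
  note M = closed_csubspace_UNIV
  have inj: "x = y" if "U x = U y" for x y
    using unitary_on_inj[OF M U _ _ that] by simp
  define Y where "Y = inv U"
  have UY: "U (Y y) = y" for y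
    unfolding Y_def by (rule surj_f_inv_f) (rule unitary_onD(2)[OF U])
  have YU: "Y (U x) = x" for x
    by (rule inj) (rule UY)
  have cY: "cinner (Y x) (Y y) = cinner x y" for x y
    using unitary_onD(3)[OF U, of "Y x" "Y y"] by (simp add: UY)
  have "bounded_clinear_on UNIV UNIV Y"
    unfolding bounded_clinear_on_def
  proof (intro conjI ballI allI exI[of _ 1])
    show "Y (x + y) = Y x + Y y" for x y
      by (rule inj) (simp add: UY bounded_clinear_on_add[OF M unitary_onD(1)[OF U]])
    show "Y (c *\<^sub>C x) = c *\<^sub>C Y x" for c x
      by (rule inj) (simp add: UY bounded_clinear_on_scaleC[OF M unitary_onD(1)[OF U]])
    show "norm (Y x) \<le> 1 * norm x" for x
      by (simp add: norm_eq_sqrt_cinner cY)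
  qed simp
  moreover have "range Y = UNIV"
    using YU by (metis surjI)
  ultimately have "unitary_on UNIV UNIV Y"
    using cY by (simp add: unitary_on_def)
  then show ?thesis
    using YU UY by blast
qed

lemma bounded_clinear_on_sum_operators:
  assumes "finite I" "\<And>i. i \<in> I \<Longrightarrow> bounded_clinear_on UNIV UNIV (A i)"
  shows "bounded_clinear_on UNIV UNIV (\<lambda>x. \<Sum>i\<in>I. A i x)"
proof -
  note M = closed_csubspace_UNIV
  obtain K where K: "\<And>i x. i \<in> I \<Longrightarrow> norm (A i x) \<le> K i * norm x"
    using assms(2) unfolding bounded_clinear_on_def by (metis UNIV_I)
  show ?thesis
    unfolding bounded_clinear_on_def
  proof (intro conjI ballI allI exI[of _ "\<Sum>i\<in>I. K i"])
    show "(\<Sum>i\<in>I. A i (x + y)) = (\<Sum>i\<in>I. A i x) + (\<Sum>i\<in>I. A i y)" for x y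
      by (simp add: bounded_clinear_on_add[OF M assms(2)] sum.distrib)
    show "(\<Sum>i\<in>I. A i (c *\<^sub>C x)) = c *\<^sub>C (\<Sum>i\<in>I. A i x)" for c x
      by (simp add: bounded_clinear_on_scaleC[OF M assms(2)] complex_vector.scale_sum_right)
    show "norm (\<Sum>i\<in>I. A i x) \<le> (\<Sum>i\<in>I. K i) * norm x" for x
      unfolding sum_distrib_right by (rule sum_norm_le) (rule K)
  qed simp
qed

section \<open>Isometric intertwiners act blockwise\<close>

context flag_intertwining
begin

text \<open>For isometric \<open>X\<close> the inverse \<open>Y\<close> is the adjoint, so a block
  of \<open>X\<close> above the diagonal is the adjoint of a block of \<open>Y\<close> below it,
  which is zero.\<close>

lemma isometric_blocks_above_zero:
  assumes iso: "\<And>x y. cinner (X x) (X y) = cinner x y"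
    and ij: "i < j" "j < n" and x: "x \<in> H j"
  shows "cproj (H' i) (X x) = 0"
proof -
  interpret flip: flag_intertwining n \<Omega> H' T' D' S' H T D S Y X
    by (rule flip)
  have i: "i < n" using ij by simp
  define z where "z = cproj (H' i) (X x)"
  have z: "z \<in> H' i"
    unfolding z_def by (rule G.cproj_mem[OF i])
  have "cinner z z = cinner (X x) z"
    using G.cinner_cproj[OF i z, of "X x"] by (simp add: z_def)
  also have "\<dots> = cinner x (Y z)"
    using iso[of x "Y z"] by (simp add: XY)
  also have "\<dots> = cinner x (cproj (H j) (Y z))"
    using F.cinner_cproj[OF ij(2) x, of "Y z"] by (metis cinner_commute)
  also have "cproj (H j) (Y z) = 0"
    using flip.triangular[OF i] ij z by blast
  finally show ?thesis
    by (simp add: z_def)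
qed

lemma isometric_block_diagonal:
  assumes iso: "\<And>x y. cinner (X x) (X y) = cinner x y"
    and "i < n" "j < n" "i \<noteq> j" "x \<in> H j"
  shows "cproj (H' i) (X x) = 0"
proof (cases "i < j")
  case True
  then show ?thesis
    using isometric_blocks_above_zero[OF iso] assms by blast
next
  case False
  then show ?thesis
    using triangular[OF \<open>j < n\<close>] assms by simp
qed

lemma isometric_mem:
  assumes iso: "\<And>x y. cinner (X x) (X y) = cinner x y" and j: "j < n" and x: "x \<in> H j"
  shows "X x \<in> H' j"
proof -
  have "X x = cproj (H' j) (X x)"
  proof (rule G.eqI)
    show "cproj (H' i) (X x) = cproj (H' i) (cproj (H' j) (X x))" if "i < n" for i
      using isometric_block_diagonal[OF iso that j _ x] G.cproj_component[OF G.cproj_mem[OF j] that j]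
      by simp
  qed
  then show ?thesis
    using G.cproj_mem[OF j] by metis
qed

text \<open>Block diagonality sends each \<open>H m\<close> into \<open>H' m\<close>, so the images
  of the components of \<open>z\<close> are the components of \<open>X z\<close>.\<close>

lemma isometric_cproj:
  assumes iso: "\<And>x y. cinner (X x) (X y) = cinner x y" and i: "i < n"
  shows "cproj (H' i) (X z) = X (cproj (H i) z)"
  unfolding F.operator_eq_sum[OF X, of z]
  by (rule G.cproj_sum[OF _ i]) (rule isometric_mem[OF iso _ F.cproj_mem])

lemma isometric_unitary_on:
  assumes iso: "\<And>x y. cinner (X x) (X y) = cinner x y" and j: "j < n"
  shows "unitary_on (H j) (H' j) X"
proof -
  interpret flip: flag_intertwining n \<Omega> H' T' D' S' H T D S Y X
    by (rule flip)
  have iso': "cinner (Y x) (Y y) = cinner x y" for x y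
    using iso[of "Y x" "Y y"] by (simp add: XY)
  have "X ` H j = H' j"
  proof
    show "X ` H j \<subseteq> H' j"
      using isometric_mem[OF iso j] by blast
    show "H' j \<subseteq> X ` H j"
    proof
      fix y assume "y \<in> H' j"
      then have "Y y \<in> H j"
        by (rule flip.isometric_mem[OF iso' j])
      then show "y \<in> X ` H j"
        using XY[of y] by (metis imageI)
    qed
  qed
  then show ?thesis
    using iso bounded_clinear_on_subset[OF X, of "H j" "H' j"] by (simp add: unitary_on_def)
qed

lemma isometric_diag:
  assumes iso: "\<And>x y. cinner (X x) (X y) = cinner x y" and i: "i < n" and x: "x \<in> H i"
  shows "X (D i x) = D' i (X x)"
proof -
  have "X (D i x) = X (cproj (H i) (T x))"
    using F.T_block[OF x i i] by simp
  also have "\<dots> = cproj (H' i) (T' (X x))"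
    using isometric_cproj[OF iso i, of "T x"] by (simp add: XT)
  also have "\<dots> = D' i (X x)"
    using G.T_block[OF isometric_mem[OF iso i x] i i] by simp
  finally show ?thesis .
qed

lemma isometric_off_diag:
  assumes iso: "\<And>x y. cinner (X x) (X y) = cinner x y" and ij: "i < j" "j < n" and x: "x \<in> H j"
  shows "X (S i j x) = S' i j (X x)"
proof -
  have i: "i < n" using ij by simp
  have "X (S i j x) = X (cproj (H i) (T x))"
    using F.T_block[OF x i ij(2)] ij by simp
  also have "\<dots> = cproj (H' i) (T' (X x))"
    using isometric_cproj[OF iso i, of "T x"] by (simp add: XT)
  also have "\<dots> = S' i j (X x)"
    using G.T_block[OF isometric_mem[OF iso ij(2) x] i ij(2)] ij by simp
  finally show ?thesis .
qed

end

text \<open>The orthogonal sum \<open>V\<close> of the blocks \<open>U i\<close> is unitary, and it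
  intertwines because the matrices of \<open>T\<close> and \<open>T'\<close> correspond entry by
  entry.\<close>

lemma unitarily_equivalent_if_blocks:
  assumes F: "flag n H \<Omega> T D S" and G: "flag n H' \<Omega> T' D' S'"
    and U: "\<And>i. i < n \<Longrightarrow> unitary_on (H i) (H' i) (U i)"
    and UD: "\<And>i x. i < n \<Longrightarrow> x \<in> H i \<Longrightarrow> U i (D i x) = D' i (U i x)"
    and US: "\<And>i j x. i < j \<Longrightarrow> j < n \<Longrightarrow> x \<in> H j \<Longrightarrow> U i (S i j x) = S' i j (U j x)"
  shows "unitarily_equivalent T T'"
proof -
  interpret F: flag n H \<Omega> T D S by (rule F)
  interpret G: flag n H' \<Omega> T' D' S' by (rule G)
  note Ub = unitary_onD(1)[OF U]
  have Umem: "U i x \<in> H' i" if "i < n" "x \<in> H i" for i x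
    using bounded_clinear_on_mem[OF F.closed_csubspace Ub] that by blast
  define V where "V x = (\<Sum>i<n. U i (cproj (H i) x))" for x
  have V: "bounded_clinear_on UNIV UNIV V"
    unfolding V_def
  proof (rule bounded_clinear_on_sum_operators)
    fix i assume "i \<in> {..<n}"
    then have i: "i < n" by simp
    show "bounded_clinear_on UNIV UNIV (\<lambda>x. U i (cproj (H i) x))"
      using bounded_clinear_on_subset[OF bounded_clinear_on_compose
          [OF F.bounded_clinear_on_cproj[OF i] Ub[OF i]], of UNIV UNIV]
      by (simp add: comp_def)
  qed simp
  have PV: "cproj (H' i) (V x) = U i (cproj (H i) x)" if "i < n" for i x
    unfolding V_def by (rule G.cproj_sum[OF Umem[OF _ F.cproj_mem] that])
  have "cinner (V x) (V y) = cinner x y" for x y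
    unfolding G.cinner_eq_sum[of "V x" "V y"] F.cinner_eq_sum[of x y]
    by (intro sum.cong refl) (simp add: PV unitary_onD(3)[OF U] F.cproj_mem)
  moreover have "range V = UNIV"
  proof -
    have "\<exists>x. V x = y" for y
    proof -
      have "\<exists>x\<in>H i. U i x = cproj (H' i) y" if "i < n" for i
        using unitary_onD(2)[OF U[OF that]] G.cproj_mem[OF that, of y] by (metis imageE)
      then obtain f where f: "\<And>i. i < n \<Longrightarrow> f i \<in> H i" "\<And>i. i < n \<Longrightarrow> U i (f i) = cproj (H' i) y"
        by metis
      have "V (\<Sum>i<n. f i) = y"
        by (rule G.eqI) (simp add: PV F.cproj_sum[OF f(1)] f(2))
      then show ?thesis ..
    qed
    then show ?thesis
      by (metis surj_def)
  qed
  ultimately have "unitary_on UNIV UNIV V"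
    using V by (simp add: unitary_on_def)
  moreover have "V (T x) = T' (V x)" for x
  proof (rule G.eqI)
    fix i assume i: "i < n"
    have "cproj (H' i) (V (T x)) = U i (\<Sum>m<n. cproj (H i) (T (cproj (H m) x)))"
      using F.T_row[OF i, of x] by (simp add: PV[OF i])
    also have "\<dots> = (\<Sum>m<n. U i (cproj (H i) (T (cproj (H m) x))))"
      by (rule bounded_clinear_on_sum[OF F.closed_csubspace[OF i] Ub[OF i]]) (rule F.cproj_mem[OF i])
    \<comment> \<open>Entries above the diagonal agree by \<open>US\<close>, those on it by
      \<open>UD\<close>, and those below it are zero on both sides.\<close>
    also have "\<dots> = (\<Sum>m<n. cproj (H' i) (T' (cproj (H' m) (V x))))"
    proof (rule sum.cong[OF refl])
      fix m assume "m \<in> {..<n}"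
      then have m: "m < n" by simp
      note p = F.cproj_mem[OF m, of x]
      have "U i (cproj (H i) (T (cproj (H m) x))) = cproj (H' i) (T' (U m (cproj (H m) x)))"
        unfolding F.T_block[OF p i m] G.T_block[OF Umem[OF m p] i m]
        using US[OF _ m p] UD[OF i] p bounded_clinear_on_zero[OF F.closed_csubspace[OF i] Ub[OF i]]
        by auto
      then show "U i (cproj (H i) (T (cproj (H m) x))) = cproj (H' i) (T' (cproj (H' m) (V x)))"
        by (simp add: PV[OF m])
    qed
    also have "\<dots> = cproj (H' i) (T' (V x))"
      by (rule G.T_row[OF i, symmetric])
    finally show "cproj (H' i) (V (T x)) = cproj (H' i) (T' (V x))" .
  qed
  ultimately show ?thesis
    unfolding unitarily_equivalent_def by (intro exI[of _ V]) (simp add: fun_eq_iff)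
qed

section \<open>From the flag class to the three assertions\<close>

lemma flag_if_flag_class:
  assumes "open \<Omega>" "connected \<Omega>" "n \<ge> 2" "T \<in> flag_class n \<Omega>" "flag_decomposition n \<Omega> T H D S"
  shows "flag n H \<Omega> T D S"
proof
  show "orthogonal_decomposition n H"
    using assms(5) by (simp add: flag_decomposition_def)
  show "bounded_clinear_on UNIV UNIV T"
    using assms(4) by (simp add: flag_class_def cowen_douglas_def)
  show "\<Omega> \<noteq> {}"
  proof
    \<comment> \<open>Without eigenvectors the summand \<open>H 1\<close> would be zero,
      contradicting \<open>S 0 1 \<noteq> 0\<close>; this entry exists because
      \<open>n \<ge> 2\<close>.\<close>
    assume "\<Omega> = {}"
    moreover have cd: "cowen_douglas 1 \<Omega> (H 1) (D 1)"
      using assms(3,5) by (simp add: flag_decomposition_def)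
    ultimately have "H 1 = {0}"
      using cowen_douglasD(5)[OF cd] by (simp add: complex_vector.span_empty)
    moreover have S: "bounded_clinear_on (H 1) (H 0) (S 0 1)" "\<exists>x\<in>H 1. S 0 1 x \<noteq> 0"
      using assms(3,5) unfolding flag_decomposition_def by (auto dest: spec[of _ "0::nat"])
    ultimately show False
      using bounded_clinear_on_zero[OF cowen_douglasD(1)[OF cd] S(1)] by auto
  qed
qed (use assms in auto)

theorem mainTheorem3:
  fixes \<Omega> :: "complex set" and n :: nat
    and T :: "'a::separable_chilbert_space \<Rightarrow> 'a"
    and T' :: "'b::separable_chilbert_space \<Rightarrow> 'b"
    and H :: "nat \<Rightarrow> 'a set" and H' :: "nat \<Rightarrow> 'b set"
    and D :: "nat \<Rightarrow> 'a \<Rightarrow> 'a" and D' :: "nat \<Rightarrow> 'b \<Rightarrow> 'b"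
    and S :: "nat \<Rightarrow> nat \<Rightarrow> 'a \<Rightarrow> 'a" and S' :: "nat \<Rightarrow> nat \<Rightarrow> 'b \<Rightarrow> 'b"
  assumes "open \<Omega>" and "connected \<Omega>" and "n \<ge> 2"
    and "T \<in> flag_class n \<Omega>" and "flag_decomposition n \<Omega> T H D S"
    and "T' \<in> flag_class n \<Omega>" and "flag_decomposition n \<Omega> T' H' D' S'"
  shows
    "(\<forall>X :: 'a \<Rightarrow> 'b. invertible_operator X \<longrightarrow> X \<circ> T = T' \<circ> X \<longrightarrow>
        block_upper_triangular n H H' X) \<and>
     (\<forall>U :: 'a \<Rightarrow> 'b. unitary_on UNIV UNIV U \<longrightarrow> U \<circ> T = T' \<circ> U \<longrightarrow>
        block_diagonal n H H' U) \<and>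
     (unitarily_equivalent T T' \<longleftrightarrow>
        (\<exists>U :: nat \<Rightarrow> 'a \<Rightarrow> 'b.
           (\<forall>i<n. unitary_on (H i) (H' i) (U i)) \<and>
           (\<forall>i<n. \<forall>x\<in>H i. cadjoint_on (H i) (U i) (D' i (U i x)) = D i x) \<and>
           (\<forall>j<n. \<forall>i<j. \<forall>x\<in>H j. U i (S i j x) = S' i j (U j x))))"
proof -
  have F: "flag n H \<Omega> T D S" and G: "flag n H' \<Omega> T' D' S'"
    using flag_if_flag_class assms by blast+
  interpret F: flag n H \<Omega> T D S by (rule F)
  interpret G: flag n H' \<Omega> T' D' S' by (rule G)
  have intertwining: "flag_intertwining n \<Omega> H T D S H' T' D' S' X Y"
    if "bounded_clinear_on UNIV UNIV X" "bounded_clinear_on UNIV UNIV Y"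
      "X \<circ> T = T' \<circ> X" "\<And>x. Y (X x) = x" "\<And>y. X (Y y) = y" for X Y
    by unfold_locales (fact that comp_eq_dest[OF that(3)])+
  have unitary: "\<exists>Y. flag_intertwining n \<Omega> H T D S H' T' D' S' U Y"
    if U: "unitary_on UNIV UNIV U" and UT: "U \<circ> T = T' \<circ> U" for U
  proof -
    obtain Y where Y: "unitary_on UNIV UNIV Y" "\<forall>x. Y (U x) = x" "\<forall>y. U (Y y) = y"
      using unitary_inverse[OF U] by blast
    have "flag_intertwining n \<Omega> H T D S H' T' D' S' U Y"
      using Y(2,3) by (intro intertwining[OF unitary_onD(1)[OF U] unitary_onD(1)[OF Y(1)] UT]) auto
    then show ?thesis by blast
  qed
  have iso: "cinner (U x) (U y) = cinner x y" if "unitary_on UNIV UNIV U" for U :: "'a \<Rightarrow> 'b" and x y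
    using unitary_onD(3)[OF that] by simp
  have part1: "block_upper_triangular n H H' X"
    if X: "invertible_operator X" and XT: "X \<circ> T = T' \<circ> X" for X
  proof -
    obtain Y where Y: "bounded_clinear_on UNIV UNIV X" "bounded_clinear_on UNIV UNIV Y"
      "Y \<circ> X = id" "X \<circ> Y = id"
      using X unfolding invertible_operator_def by blast
    interpret flag_intertwining n \<Omega> H T D S H' T' D' S' X Y
      by (rule intertwining[OF Y(1,2) XT]) (use fun_cong[OF Y(3)] fun_cong[OF Y(4)] in auto)
    show ?thesis
      unfolding block_upper_triangular_def using triangular by blast
  qed
  have part2: "block_diagonal n H H' U"
    if U: "unitary_on UNIV UNIV U" and UT: "U \<circ> T = T' \<circ> U" for U
  proof -
    obtain Y where "flag_intertwining n \<Omega> H T D S H' T' D' S' U Y"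
      using unitary[OF U UT] by blast
    from flag_intertwining.isometric_block_diagonal[OF this iso[OF U]] show ?thesis
      unfolding block_diagonal_def by blast
  qed
  have part3: "unitarily_equivalent T T' \<longleftrightarrow>
        (\<exists>U :: nat \<Rightarrow> 'a \<Rightarrow> 'b.
           (\<forall>i<n. unitary_on (H i) (H' i) (U i)) \<and>
           (\<forall>i<n. \<forall>x\<in>H i. cadjoint_on (H i) (U i) (D' i (U i x)) = D i x) \<and>
           (\<forall>j<n. \<forall>i<j. \<forall>x\<in>H j. U i (S i j x) = S' i j (U j x)))"
    (is "_ \<longleftrightarrow> ?R")
  proof
    assume "unitarily_equivalent T T'"
    then obtain U :: "'a \<Rightarrow> 'b" where U: "unitary_on UNIV UNIV U" "U \<circ> T = T' \<circ> U"
      unfolding unitarily_equivalent_def by blast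
    then obtain Y where "flag_intertwining n \<Omega> H T D S H' T' D' S' U Y"
      using unitary by blast
    then interpret flag_intertwining n \<Omega> H T D S H' T' D' S' U Y .
    have Ui: "unitary_on (H i) (H' i) U" if "i < n" for i
      by (rule isometric_unitary_on[OF iso[OF U(1)] that])
    have "cadjoint_on (H i) U (D' i (U x)) = D i x" if "i < n" "x \<in> H i" for i x
      using cadjoint_on_unitary[OF F.closed_csubspace[OF that(1)] Ui[OF that(1)] F.D_mem[OF that]]
      by (simp add: isometric_diag[OF iso[OF U(1)] that])
    \<comment> \<open>One operator \<open>U\<close> serves for all indices, since only its values on
      \<open>H i\<close> matter for the \<open>i\<close>-th block.\<close>
    then show ?R
      using Ui isometric_off_diag[OF iso[OF U(1)]] by (intro exI[of _ "\<lambda>_. U"]) auto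
  next
    assume ?R
    then obtain U where U: "\<And>i. i < n \<Longrightarrow> unitary_on (H i) (H' i) (U i)"
      and UD: "\<And>i x. i < n \<Longrightarrow> x \<in> H i \<Longrightarrow> cadjoint_on (H i) (U i) (D' i (U i x)) = D i x"
      and US: "\<And>i j x. i < j \<Longrightarrow> j < n \<Longrightarrow> x \<in> H j \<Longrightarrow> U i (S i j x) = S' i j (U j x)"
      by metis
    \<comment> \<open>Surjectivity writes \<open>D' i (U i x)\<close> as \<open>U i z\<close>; the
      adjoint returns \<open>z\<close>, so the hypothesis identifies \<open>z\<close> with
      \<open>D i x\<close>.\<close>
    have "U i (D i x) = D' i (U i x)" if i: "i < n" and x: "x \<in> H i" for i x
    proof -
      have "D' i (U i x) \<in> H' i"
        using G.D_mem[OF i] unitary_onD(2)[OF U[OF i]] x by blast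
      then obtain z where z: "z \<in> H i" "D' i (U i x) = U i z"
        using unitary_onD(2)[OF U[OF i]] by blast
      then show ?thesis
        using UD[OF i x] cadjoint_on_unitary[OF F.closed_csubspace[OF i] U[OF i] z(1)] by simp
    qed
    then show "unitarily_equivalent T T'"
      using unitarily_equivalent_if_blocks[OF F G U _ US] by blast
  qed
  from part1 part2 part3 show ?thesis by blast
qed

end
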